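(* For every connected series-parallel multigraph $G$ (with a fixed ordering of $E(G)$) there exist constants $c_1,c_2,c_3,c_4>0$ such that the following holds: if $n\ge e(G)$, $S\subseteq V(Q_n)$ has size $\delta 2^n$, and $\delta\ge c_1n^{-c_2}$, then at least a $c_3\delta^{c_4}$-proportion of all oriented embeddings $\psi: Q_{e(G)}\to Q_n$ satisfy $\psi(X(G))\subseteq S$.
   Context: Multigraphs may have loops and parallel edges; $e(G)=|E(G)|$. A series-parallel graph is a multigraph with no $K_4$ minor. $X(G)\subseteq\{0,1\}^{E(G)} = V(Q_{e(G)})$ is the set of indicator strings of edge sets of spanning trees of $G$. $Q_n$ is the hypercube on $\{0,1\}^n$. An embedding $Q_d\to Q_n$ is a graph isomorphism of $Q_d$ onto a $d$-dimensional face of $Q_n$; it is oriented if it preserves the coordinatewise partial orders on $\{0,1\}^d$ and $\{0,1\}^n$ (equivalently, it has the form $\psi(x)_{\sigma(j)} = x_j$ for an injection $\sigma:[d]\to[n]$, with the coordinates outside $\sigma([d])$ fixed to constant values). *)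

theory Defs
  imports Complex_Main "HOL-Library.FuncSet"
begin

section \<open>Finite undirected multigraphs\<close>

text \<open>
  An edge is an abstract object with a set of one or two end vertices. An edge with a single
  end is a loop; distinct edges with the same ends are parallel.
\<close>

record ('v, 'e) multigraph =
  vertices :: "'v set"
  edges :: "'e set"
  ends :: "'e \<Rightarrow> 'v set"

definition wf_multigraph :: "('v, 'e, 'z) multigraph_scheme \<Rightarrow> bool" where
  "wf_multigraph G \<longleftrightarrow>
     finite (vertices G) \<and> finite (edges G) \<and>
     (\<forall>e\<in>edges G. ends G e \<subseteq> vertices G \<and> card (ends G e) \<in> {1, 2})"

definition adjacency :: "('v, 'e, 'z) multigraph_scheme \<Rightarrow> ('v \<times> 'v) set" where
  "adjacency G = {(u, v). \<exists>e\<in>edges G. ends G e = {u, v}}"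

definition connected_multigraph :: "('v, 'e, 'z) multigraph_scheme \<Rightarrow> bool" where
  "connected_multigraph G \<longleftrightarrow>
     vertices G \<noteq> {} \<and> (\<forall>u\<in>vertices G. \<forall>v\<in>vertices G. (u, v) \<in> (adjacency G)\<^sup>*)"

text \<open>
  A cycle is given by its distinct vertices and its distinct edges in cyclic order. A loop is a
  cycle of length 1, and two parallel edges form a cycle of length 2.
\<close>

definition is_cycle :: "('v, 'e, 'z) multigraph_scheme \<Rightarrow> 'v list \<Rightarrow> 'e list \<Rightarrow> bool" where
  "is_cycle G vs es \<longleftrightarrow>
     es \<noteq> [] \<and> length vs = length es \<and>
     distinct vs \<and> distinct es \<and> set vs \<subseteq> vertices G \<and> set es \<subseteq> edges G \<and>
     (\<forall>i<length es. ends G (es ! i) = {vs ! i, vs ! (Suc i mod length es)})"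

definition is_tree :: "('v, 'e, 'z) multigraph_scheme \<Rightarrow> bool" where
  "is_tree G \<longleftrightarrow> connected_multigraph G \<and> (\<nexists>vs es. is_cycle G vs es)"

definition spanning_tree_edges :: "('v, 'e, 'z) multigraph_scheme \<Rightarrow> 'e set \<Rightarrow> bool" where
  "spanning_tree_edges G T \<longleftrightarrow> T \<subseteq> edges G \<and> is_tree (G\<lparr>edges := T\<rparr>)"

text \<open>
  \<open>H\<close> is a minor of \<open>G\<close>: there are disjoint connected branch sets \<open>B x\<close> in \<open>G\<close>, one for each
  vertex \<open>x\<close> of \<open>H\<close>, and distinct edges \<open>\<phi> f\<close> of \<open>G\<close>, one for each edge \<open>f\<close> of \<open>H\<close>, joining the
  corresponding branch sets; contracting the branch sets then yields \<open>H\<close> up to deletions.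
  The edges \<open>\<phi> f\<close> may not be used to connect a branch set; this matters only for loops of \<open>H\<close>.
\<close>

definition is_minor ::
  "('w, 'f, 'y) multigraph_scheme \<Rightarrow> ('v, 'e, 'z) multigraph_scheme \<Rightarrow> bool" where
  "is_minor H G \<longleftrightarrow>
     (\<exists>B \<phi>.
        (\<forall>x\<in>vertices H. B x \<subseteq> vertices G) \<and>
        (\<forall>x\<in>vertices H. \<forall>y\<in>vertices H. x \<noteq> y \<longrightarrow> B x \<inter> B y = {}) \<and>
        inj_on \<phi> (edges H) \<and> \<phi> ` edges H \<subseteq> edges G \<and>
        (\<forall>x\<in>vertices H. connected_multigraph
           (G\<lparr>vertices := B x, edges := {e \<in> edges G - \<phi> ` edges H. ends G e \<subseteq> B x}\<rparr>)) \<and>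
        (\<forall>f\<in>edges H. \<forall>x y. ends H f = {x, y} \<longrightarrow>
           (\<exists>a\<in>B x. \<exists>b\<in>B y. ends G (\<phi> f) = {a, b})))"

definition K4 :: "(nat, nat set) multigraph" where
  "K4 = \<lparr>vertices = {..<4}, edges = {e. e \<subseteq> {..<4} \<and> card e = 2}, ends = (\<lambda>e. e)\<rparr>"

definition series_parallel :: "('v, 'e, 'z) multigraph_scheme \<Rightarrow> bool" where
  "series_parallel G \<longleftrightarrow> wf_multigraph G \<and> \<not> is_minor K4 G"


section \<open>The hypercube and its oriented embeddings\<close>

text \<open>
  A vertex of the \<open>n\<close>-dimensional cube is a list of \<open>n\<close> bits, with \<open>False\<close> for 0 and \<open>True\<close>
  for 1, so that the order on \<open>bool\<close> is the order on \<open>{0, 1}\<close>.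
\<close>

definition cube :: "nat \<Rightarrow> bool list set" where
  "cube n = {x. length x = n}"

definition cube_adj :: "nat \<Rightarrow> bool list \<Rightarrow> bool list \<Rightarrow> bool" where
  "cube_adj n x y \<longleftrightarrow> x \<in> cube n \<and> y \<in> cube n \<and> card {i. i < n \<and> x ! i \<noteq> y ! i} = 1"

definition cube_le :: "bool list \<Rightarrow> bool list \<Rightarrow> bool" where
  "cube_le x y \<longleftrightarrow> list_all2 (\<le>) x y"

definition is_face :: "nat \<Rightarrow> nat \<Rightarrow> bool list set \<Rightarrow> bool" where
  "is_face n d F \<longleftrightarrow>
     (\<exists>J a. J \<subseteq> {..<n} \<and> card J = d \<and> a \<in> cube n \<and>
        F = {x \<in> cube n. \<forall>i\<in>{..<n} - J. x ! i = a ! i})"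

text \<open>
  Embeddings are required to be \<open>undefined\<close> outside \<open>cube d\<close>, so that they can be counted.
\<close>

definition cube_embedding :: "nat \<Rightarrow> nat \<Rightarrow> (bool list \<Rightarrow> bool list) \<Rightarrow> bool" where
  "cube_embedding d n \<psi> \<longleftrightarrow>
     \<psi> \<in> extensional (cube d) \<and>
     (\<exists>F. is_face n d F \<and> bij_betw \<psi> (cube d) F) \<and>
     (\<forall>x\<in>cube d. \<forall>y\<in>cube d. cube_adj d x y \<longleftrightarrow> cube_adj n (\<psi> x) (\<psi> y))"

definition oriented_embeddings :: "nat \<Rightarrow> nat \<Rightarrow> (bool list \<Rightarrow> bool list) set" where
  "oriented_embeddings d n =
     {\<psi>. cube_embedding d n \<psi> \<and>
          (\<forall>x\<in>cube d. \<forall>y\<in>cube d. cube_le x y \<longrightarrow> cube_le (\<psi> x) (\<psi> y))}"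

text \<open>
  The list \<open>es\<close> is an enumeration of \<open>edges G\<close> without repetitions; it fixes the ordering of the
  edges that identifies sets of edges with vertices of the cube.
\<close>

definition spanning_tree_strings ::
  "('v, 'e, 'z) multigraph_scheme \<Rightarrow> 'e list \<Rightarrow> bool list set" where
  "spanning_tree_strings G es = {map (\<lambda>e. e \<in> T) es | T. spanning_tree_edges G T}"

end

theory Submission
  imports Defs
begin

text \<open>
  A connected multigraph without a \<open>K4\<close> minor can be reduced to a single vertex by deleting loops,
  pendant vertices and parallel edges, and by suppressing vertices of degree 2. Each inverse step
  changes the family of spanning trees in a simple way: it adds a coordinate that is constantly 0
  or constantly 1, or it splits one coordinate \<open>e\<close> into two, replacing \<open>1, 0\<close> by \<open>{10, 01}, {00}\<close>
  (parallel) or by \<open>{11}, {10, 01}\<close> (series). Complementing all bits exchanges the two kinds of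
  each step, so only the constant 0 and the parallel step need an argument. For the parallel step, two
  good embeddings that differ only in the image of \<open>e\<close> combine to one good embedding of the larger
  cube, and by convexity the proportion of good embeddings is at worst squared up to a constant.
\<close>

section \<open>Families with polynomially many copies in dense sets\<close>

text \<open>There is one step for every edge, so each step may lose only polynomially. A coordinate
  that is constantly 0 needs a position off \<open>Z\<close>; discarding the few \<open>Z\<close>
  with many more than \<open>n / 2\<close> elements is affordable only if the copies outnumber them,
  and this is one source of the threshold on \<open>\<delta> ^ k * n\<close>. The other is the
  parallel step: there the threshold makes the average number of images of \<open>e\<close> at least
  2, so that discarding pairs of equal images costs at most half. Loops and bridges keep the
  exponent \<open>k\<close>; parallel and series steps double it. Spanning trees enter as
  inclusion-minimal connecting edge sets, so a reduction only has to push connectivity along a map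
  of vertices. Its effect is recorded as an inclusion of families, because copies of a larger family
  are copies of a smaller one. That a reduction always exists rests on a vertex with at most two
  neighbours. The induction behind it must tolerate two adjacent vertices of small degree, whose
  degrees the contractions and deletions may spoil.\<close>

text \<open>
  A pair \<open>(\<sigma>, Z)\<close> encodes the oriented embedding \<open>T \<mapsto> Z \<union> \<sigma> ` T\<close> on sets of coordinates: \<open>\<sigma>\<close> names the
  free coordinates and \<open>Z\<close> is the set of coordinates that are constantly 1.
\<close>

definition configurations :: "'e set \<Rightarrow> nat \<Rightarrow> (('e \<Rightarrow> nat) \<times> nat set) set" where
  "configurations E n =
     {(\<sigma>, Z). \<sigma> \<in> E \<rightarrow>\<^sub>E {..<n} \<and> inj_on \<sigma> E \<and> Z \<subseteq> {..<n} - \<sigma> ` E}"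

definition copies :: "'e set \<Rightarrow> 'e set set \<Rightarrow> nat \<Rightarrow> nat set set \<Rightarrow> (('e \<Rightarrow> nat) \<times> nat set) set" where
  "copies E F n S = {(\<sigma>, Z) \<in> configurations E n. \<forall>T\<in>F. Z \<union> \<sigma> ` T \<in> S}"

text \<open>
  One exponent \<open>k\<close> serves both the density threshold and the bound. The total number of
  configurations is replaced by its upper bound \<open>n ^ card E * 2 ^ n\<close>, and \<open>n = 0\<close> is included so
  that the case of no coordinates needs no special treatment.
\<close>

definition polynomially_dense :: "'e set \<Rightarrow> 'e set set \<Rightarrow> bool" where
  "polynomially_dense E F \<longleftrightarrow>
     (\<exists>C k. C \<ge> (1::real) \<and> k \<ge> (1::nat) \<and>
       (\<forall>n S \<delta>. S \<subseteq> Pow {..<n} \<longrightarrow> real (card S) = \<delta> * 2 ^ n \<longrightarrow> n = 0 \<or> C \<le> \<delta> ^ k * n \<longrightarrow>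
          \<delta> ^ k * n ^ card E * 2 ^ n \<le> C * card (copies E F n S)))"

text \<open>As a proportion, \<open>\<delta>\<close> lies between 0 and 1 automatically; having
  these bounds at hand lets different powers of \<open>\<delta>\<close> be compared.\<close>

lemma polynomially_denseI:
  assumes "C \<ge> 1" "k \<ge> 1"
    and "\<And>n S \<delta>. S \<subseteq> Pow {..<n} \<Longrightarrow> real (card S) = \<delta> * 2 ^ n \<Longrightarrow> 0 \<le> \<delta> \<Longrightarrow> \<delta> \<le> 1
      \<Longrightarrow> n = 0 \<or> C \<le> \<delta> ^ k * n \<Longrightarrow> \<delta> ^ k * n ^ card E * 2 ^ n \<le> C * card (copies E F n S)"
  shows "polynomially_dense E F"
  unfolding polynomially_dense_def
proof (intro exI[of _ C] exI[of _ k] conjI allI impI)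
  fix n S \<delta> assume S: "S \<subseteq> Pow {..<n}" "real (card S) = \<delta> * 2 ^ n" and *: "n = 0 \<or> C \<le> \<delta> ^ k * n"
  have "card S \<le> 2 ^ n"
    using card_mono[OF _ S(1)] by (simp add: card_Pow)
  then have "\<delta> * 2 ^ n \<le> 1 * 2 ^ n" using S(2)
    by (metis mult_1 of_nat_le_iff of_nat_numeral of_nat_power)
  then have "\<delta> \<le> 1" by simp
  moreover have "\<delta> = card S / 2 ^ n" using S(2) by simp
  then have "0 \<le> \<delta>" by simp
  ultimately show "\<delta> ^ k * n ^ card E * 2 ^ n \<le> C * card (copies E F n S)"
    using assms(3) S * by blast
qed (use assms in auto)

lemma finite_configurations: "finite E \<Longrightarrow> finite (configurations E n)"
  by (rule finite_subset[of _ "(E \<rightarrow>\<^sub>E {..<n}) \<times> Pow {..<n}"])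
     (auto simp: configurations_def finite_PiE)

lemma finite_copies: "finite E \<Longrightarrow> finite (copies E F n S)"
  by (rule finite_subset[OF _ finite_configurations]) (auto simp: copies_def)

lemma configurations_insert:
  assumes "(\<sigma>, Z) \<in> configurations E n" "f \<notin> E" "j < n" "j \<notin> Z" "j \<notin> \<sigma> ` E"
  shows "(\<sigma>(f := j), Z) \<in> configurations (insert f E) n"
proof -
  have "\<sigma> \<in> E \<rightarrow>\<^sub>E {..<n}" "inj_on \<sigma> E" "Z \<subseteq> {..<n} - \<sigma> ` E"
    using assms(1) by (auto simp: configurations_def)
  moreover have "(\<sigma>(f := j)) ` insert f E = insert j (\<sigma> ` E)"
    using assms(2) by (auto simp: image_iff)
  moreover have "inj_on (\<sigma>(f := j)) (insert f E)"
    using \<open>inj_on \<sigma> E\<close> assms(2,5) by (auto simp: inj_on_def)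
  ultimately show ?thesis
    using assms(3,4) PiE_fun_upd[of j "\<lambda>_. {..<n}" f \<sigma> E] by (auto simp: configurations_def)
qed

lemma card_configurations_le: "finite E \<Longrightarrow> card (configurations E n) \<le> n ^ card E * 2 ^ n"
proof -
  assume E: "finite E"
  have "card (configurations E n) \<le> card ((E \<rightarrow>\<^sub>E {..<n}) \<times> Pow {..<n})"
    by (rule card_mono) (auto simp: configurations_def finite_PiE E)
  also have "\<dots> = n ^ card E * 2 ^ n"
    by (simp add: card_cartesian_product card_PiE E card_Pow)
  finally show ?thesis .
qed

lemma polynomially_dense_mono:
  assumes "polynomially_dense E F" "F' \<subseteq> F" "finite E"
  shows "polynomially_dense E F'"
proof -
  have "card (copies E F n S) \<le> card (copies E F' n S)" for n S
    using assms(2) by (intro card_mono finite_copies assms) (auto simp: copies_def)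
  then have "C * card (copies E F n S) \<le> C * card (copies E F' n S)" if "C \<ge> 1" for n S and C :: real
    using that by simp
  then show ?thesis
    using assms(1) unfolding polynomially_dense_def by (meson order_trans)
qed

text \<open>Without free coordinates a copy is just a member of \<open>S\<close>, and the only
  function on the empty set is constantly \<open>undefined\<close>. Both sides agree.\<close>

lemma polynomially_dense_empty: "polynomially_dense ({} :: 'e set) {{}}"
proof (rule polynomially_denseI[of 1 1])
  fix n S and \<delta> :: real assume S: "S \<subseteq> Pow {..<n}" "real (card S) = \<delta> * 2 ^ n"
  have "copies ({} :: 'e set) {{}} n S = {\<lambda>_. undefined} \<times> S"
    using S(1) by (auto simp: copies_def configurations_def)
  then show "\<delta> ^ 1 * n ^ card ({} :: 'e set) * 2 ^ n \<le> 1 * real (card (copies ({} :: 'e set) {{}} n S))"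
    by (simp add: card_cartesian_product S(2))
qed auto

lemma polynomially_dense_dual:
  assumes "polynomially_dense E F" "finite E" "\<And>T. T \<in> F \<Longrightarrow> T \<subseteq> E"
  shows "polynomially_dense E ((\<lambda>T. E - T) ` F)"
proof -
  obtain C k where Ck: "C \<ge> 1" "k \<ge> 1"
    and dense: "\<And>n S \<delta>. S \<subseteq> Pow {..<n} \<Longrightarrow> real (card S) = \<delta> * 2 ^ n \<Longrightarrow> n = 0 \<or> C \<le> \<delta> ^ k * n \<Longrightarrow>
          \<delta> ^ k * n ^ card E * 2 ^ n \<le> C * card (copies E F n S)"
    using assms(1) unfolding polynomially_dense_def by blast
  show ?thesis
  proof (rule polynomially_denseI[OF Ck])
    fix n S and \<delta> :: real
    assume S: "S \<subseteq> Pow {..<n}" "real (card S) = \<delta> * 2 ^ n" and *: "n = 0 \<or> C \<le> \<delta> ^ k * n"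
    define S' where "S' = (\<lambda>A. {..<n} - A) ` S"
    have "inj_on (\<lambda>A. {..<n} - A) S"
      using S(1) by (intro inj_onI) blast
    then have card_S': "card S' = card S" unfolding S'_def by (rule card_image)
    define g where "g = (\<lambda>(\<sigma>, Z). (\<sigma> :: 'a \<Rightarrow> nat, {..<n} - Z - \<sigma> ` E))"
    have "inj_on g (copies E F n S')"
      by (auto simp: inj_on_def g_def copies_def configurations_def)
    moreover have "g ` copies E F n S' \<subseteq> copies E ((\<lambda>T. E - T) ` F) n S"
    proof clarify
      fix \<sigma> Z \<tau> Y assume c: "(\<sigma>, Z) \<in> copies E F n S'" and g: "(\<tau>, Y) = g (\<sigma>, Z)"
      have \<tau>: "\<tau> = \<sigma>" and Y: "Y = {..<n} - Z - \<sigma> ` E" using g by (auto simp: g_def)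
      have \<sigma>: "\<sigma> \<in> E \<rightarrow>\<^sub>E {..<n}" "inj_on \<sigma> E" "Z \<subseteq> {..<n} - \<sigma> ` E"
        using c by (auto simp: copies_def configurations_def)
      have "Y \<union> \<sigma> ` (E - T) \<in> S" if T: "T \<in> F" for T
      proof -
        have "Z \<union> \<sigma> ` T \<in> S'" using c T by (auto simp: copies_def)
        then obtain A where A: "A \<in> S" "Z \<union> \<sigma> ` T = {..<n} - A" by (auto simp: S'_def)
        have "\<sigma> ` (E - T) = \<sigma> ` E - \<sigma> ` T"
          using \<sigma>(2) assms(3)[OF T] by (metis Diff_subset inj_on_image_set_diff)
        moreover have "\<sigma> ` E \<subseteq> {..<n}" using \<sigma>(1) by auto
        moreover have "\<sigma> ` T \<subseteq> \<sigma> ` E" using assms(3)[OF T] by auto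
        moreover have "A \<subseteq> {..<n}" using A(1) S(1) by auto
        ultimately have "Y \<union> \<sigma> ` (E - T) = A"
          unfolding Y using A(2) \<sigma>(3) by (simp add: set_eq_iff subset_iff) metis
        then show ?thesis using A(1) by simp
      qed
      then show "(\<tau>, Y) \<in> copies E ((\<lambda>T. E - T) ` F) n S"
        using \<sigma> by (auto simp: copies_def configurations_def \<tau> Y)
    qed
    ultimately have "card (copies E F n S') \<le> card (copies E ((\<lambda>T. E - T) ` F) n S)"
      by (metis card_inj_on_le finite_copies assms(2))
    then have "C * card (copies E F n S') \<le> C * card (copies E ((\<lambda>T. E - T) ` F) n S)"
      using Ck by simp
    moreover have "\<delta> ^ k * n ^ card E * 2 ^ n \<le> C * card (copies E F n S')"
      by (rule dense) (use S(2) card_S' * in \<open>auto simp: S'_def\<close>)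
    ultimately show "\<delta> ^ k * n ^ card E * 2 ^ n \<le> C * card (copies E ((\<lambda>T. E - T) ` F) n S)"
      by linarith
  qed
qed

text \<open>Models an edge \<open>f\<close> added parallel to \<open>e\<close>: a tree uses at most
  one of the two, and \<open>f\<close> can stand in for \<open>e\<close>.\<close>

definition parallel_extension :: "'e \<Rightarrow> 'e \<Rightarrow> 'e set set \<Rightarrow> 'e set set" where
  "parallel_extension e f F = F \<union> {insert f (T - {e}) |T. T \<in> F \<and> e \<in> T}"

text \<open>
  Group the configurations by everything except the image \<open>i\<close> of \<open>e\<close>. Two different admissible
  images for the same remaining data give a copy of the extension, so convexity of \<open>N \<mapsto> N (N - 1)\<close>
  bounds the number of copies from below.
\<close>

lemma polynomially_dense_parallel:
  assumes "polynomially_dense E F" "finite E" "\<And>T. T \<in> F \<Longrightarrow> T \<subseteq> E" "e \<in> E" "f \<notin> E"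
  shows "polynomially_dense (insert f E) (parallel_extension e f F)"
proof -
  obtain C k where Ck: "C \<ge> 1" "k \<ge> 1"
    and dense: "\<And>n S \<delta>. S \<subseteq> Pow {..<n} \<Longrightarrow> real (card S) = \<delta> * 2 ^ n \<Longrightarrow> n = 0 \<or> C \<le> \<delta> ^ k * n \<Longrightarrow>
          \<delta> ^ k * n ^ card E * 2 ^ n \<le> C * card (copies E F n S)"
    using assms(1) unfolding polynomially_dense_def by blast
  define E0 where "E0 = E - {e}"
  have E: "E = insert e E0" "e \<notin> E0" "f \<notin> E0" "e \<noteq> f" "finite E0" "card E = Suc (card E0)"
    using assms(2,4,5) card.remove[OF assms(2,4)] by (auto simp: E0_def)
  have "C * 1 \<le> C * C" using Ck by (intro mult_left_mono) auto
  then have CC: "C \<le> C\<^sup>2" "1 \<le> C\<^sup>2" using Ck(1) unfolding power2_eq_square by linarith+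
  show ?thesis
  \<comment> \<open>The count below is \<open>M * a\<^sup>2 / 2\<close> with
    \<open>C * a = \<delta> ^ k * n\<close>, which gives the factor \<open>2 * C\<^sup>2\<close> and
    the exponent \<open>2 * k\<close>. The threshold \<open>2 * C\<^sup>2\<close> also yields
    \<open>a \<ge> 2 * C \<ge> 2\<close>.\<close>
  proof (rule polynomially_denseI[of "2 * C\<^sup>2" "2 * k"])
    fix n S and \<delta> :: real
    assume S: "S \<subseteq> Pow {..<n}" "real (card S) = \<delta> * 2 ^ n" and \<delta>: "0 \<le> \<delta>" "\<delta> \<le> 1"
      and *: "n = 0 \<or> 2 * C\<^sup>2 \<le> \<delta> ^ (2 * k) * n"
    show "\<delta> ^ (2 * k) * n ^ card (insert f E) * 2 ^ n
        \<le> 2 * C\<^sup>2 * card (copies (insert f E) (parallel_extension e f F) n S)"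
    proof (cases "n = 0")
      case True
      then show ?thesis using assms(2) Ck by (simp add: power_0_left card_gt_0_iff)
    next
      case False
      have "\<delta> ^ (2 * k) \<le> \<delta> ^ k" using \<delta> by (intro power_decreasing) auto
      then have "\<delta> ^ (2 * k) * n \<le> \<delta> ^ k * n" by (simp add: mult_right_mono)
      with * False have n: "2 * C\<^sup>2 \<le> \<delta> ^ k * n" by linarith
      \<comment> \<open>\<open>B\<close> also holds data that extend to no configuration; there
        \<open>N\<close> is empty. In return its size is exactly the normalising factor
        \<open>M\<close>.\<close>
      define B where "B = (E0 \<rightarrow>\<^sub>E {..<n}) \<times> Pow {..<n}"
      define N where "N = (\<lambda>(\<sigma>, Z). {i. (\<sigma>(e := i), Z) \<in> copies E F n S})"
      have [simp]: "finite B" by (simp add: B_def E finite_PiE)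
      have N_sub: "N c \<subseteq> {..<n}" for c
      proof
        fix i assume "i \<in> N c"
        then obtain \<sigma> Z where "(\<sigma>(e := i), Z) \<in> copies E F n S" by (auto simp: N_def split: prod.splits)
        then have "\<sigma>(e := i) \<in> E \<rightarrow>\<^sub>E {..<n}" by (auto simp: copies_def configurations_def)
        from PiE_mem[OF this assms(4)] show "i \<in> {..<n}" by simp
      qed
      have [simp]: "finite (N c)" for c using N_sub finite_subset by blast
      define a where "a = \<delta> ^ k * n / C"
      define M where "M = real (n ^ card E0 * 2 ^ n)"
      have cardB: "real (card B) = M"
        by (simp add: B_def M_def card_cartesian_product card_PiE E card_Pow)
      have a: "2 \<le> a"
      proof -
        have "2 * C * C \<le> \<delta> ^ k * n" using n by (simp add: power2_eq_square)
        then have "2 * C \<le> a" using Ck by (simp add: a_def le_divide_eq)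
        then show ?thesis using Ck by linarith
      qed
      have "card (copies E F n S) \<le> card (SIGMA c : B. N c)"
      proof (rule card_inj_on_le[where f = "\<lambda>(\<sigma>, Z). ((\<sigma>(e := undefined), Z), \<sigma> e)"])
        show "inj_on (\<lambda>(\<sigma>, Z). ((\<sigma>(e := undefined), Z), \<sigma> e)) (copies E F n S)"
          by (auto simp: inj_on_def fun_eq_iff split: if_splits)
        show "(\<lambda>(\<sigma>, Z). ((\<sigma>(e := undefined), Z), \<sigma> e)) ` copies E F n S \<subseteq> (SIGMA c : B. N c)"
        proof clarify
          fix \<sigma> Z assume c: "(\<sigma>, Z) \<in> copies E F n S"
          then have \<sigma>: "\<sigma> \<in> E \<rightarrow>\<^sub>E {..<n}" "Z \<subseteq> {..<n}" by (auto simp: copies_def configurations_def)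
          then have "\<sigma>(e := undefined) \<in> E0 \<rightarrow>\<^sub>E {..<n}"
            by (auto simp: E PiE_def extensional_def)
          then show "(\<sigma>(e := undefined), Z) \<in> B \<and> \<sigma> e \<in> N (\<sigma>(e := undefined), Z)"
            using c \<sigma> by (simp add: B_def N_def)
        qed
      qed simp
      then have "card (copies E F n S) \<le> (\<Sum>c\<in>B. card (N c))" by (simp add: card_SigmaI)
      moreover have "\<delta> ^ k * n ^ card E * 2 ^ n \<le> C * card (copies E F n S)"
      proof (rule dense[OF S])
        show "n = 0 \<or> C \<le> \<delta> ^ k * n" using n CC Ck by linarith
      qed
      moreover have "\<delta> ^ k * n ^ card E * 2 ^ n = C * (M * a)"
        using Ck by (simp add: M_def a_def E(6))
      ultimately have sumN: "M * a \<le> (\<Sum>c\<in>B. real (card (N c)))"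
        using Ck by (simp flip: of_nat_sum)
      define P where "P = (\<lambda>c. {p \<in> N c \<times> N c. fst p \<noteq> snd p})"
      have cardP: "card (P c) = card (N c) * card (N c) - card (N c)" for c
      proof -
        have "P c = N c \<times> N c - (\<lambda>i. (i, i)) ` N c" by (auto simp: P_def)
        also have "card \<dots> = card (N c \<times> N c) - card ((\<lambda>i. (i, i)) ` N c)"
          by (intro card_Diff_subset) auto
        also have "card ((\<lambda>i. (i, i)) ` N c) = card (N c)"
          by (intro card_image inj_onI) auto
        finally show ?thesis by (simp add: card_cartesian_product)
      qed
      \<comment> \<open>the tangent to \<open>N\<^sup>2 - N\<close> at the lower bound \<open>a\<close> for the average of \<open>card (N c)\<close>\<close>
      have "(2 * a - 1) * card (N c) - a\<^sup>2 \<le> card (P c)" for c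
      proof -
        have "real (card (P c)) = (card (N c))\<^sup>2 - card (N c)"
          unfolding cardP by (subst of_nat_diff) (auto simp: power2_eq_square)
        moreover have "0 \<le> (card (N c) - a)\<^sup>2" by simp
        ultimately show ?thesis by (simp add: power2_eq_square algebra_simps)
      qed
      then have "(\<Sum>c\<in>B. (2 * a - 1) * card (N c) - a\<^sup>2) \<le> (\<Sum>c\<in>B. real (card (P c)))"
        by (intro sum_mono)
      then have "(2 * a - 1) * (\<Sum>c\<in>B. real (card (N c))) - M * a\<^sup>2 \<le> (\<Sum>c\<in>B. real (card (P c)))"
        by (simp add: sum_subtractf sum_distrib_left cardB)
      moreover have "(2 * a - 1) * (M * a) \<le> (2 * a - 1) * (\<Sum>c\<in>B. real (card (N c)))"
        using a sumN by (intro mult_left_mono) auto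
      \<comment> \<open>The right side is \<open>M * (a\<^sup>2 - a)\<close>, and
        \<open>a \<ge> 2\<close> makes the subtracted diagonal at most half of the square.\<close>
      moreover have "M * a\<^sup>2 / 2 \<le> (2 * a - 1) * (M * a) - M * a\<^sup>2"
      proof -
        have "0 \<le> M * a * (a - 2)" using a by (intro mult_nonneg_nonneg) (auto simp: M_def)
        then show ?thesis by (simp add: power2_eq_square algebra_simps)
      qed
      moreover have "card (SIGMA c : B. P c) \<le> card (copies (insert f E) (parallel_extension e f F) n S)"
      proof (rule card_inj_on_le[where f = "\<lambda>((\<sigma>, Z), (i, j)). (\<sigma>(e := i, f := j), Z)"])
        show "inj_on (\<lambda>((\<sigma>, Z), (i, j)). (\<sigma>(e := i, f := j), Z)) (SIGMA c : B. P c)"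
        proof (rule inj_onI)
          fix p q assume pq: "p \<in> (SIGMA c : B. P c)" "q \<in> (SIGMA c : B. P c)"
            "(\<lambda>((\<sigma>, Z), (i, j)). (\<sigma>(e := i, f := j), Z)) p = (\<lambda>((\<sigma>, Z), (i, j)). (\<sigma>(e := i, f := j), Z)) q"
          obtain \<sigma> Z i j where p: "p = ((\<sigma>, Z), i, j)" by (metis surj_pair)
          obtain \<tau> Z' i' j' where q: "q = ((\<tau>, Z'), i', j')" by (metis surj_pair)
          have B: "(\<sigma>, Z) \<in> B" "(\<tau>, Z') \<in> B" and eq: "\<sigma>(e := i, f := j) = \<tau>(e := i', f := j')" "Z = Z'"
            using pq by (simp_all add: p q)
          have "\<sigma> x = \<tau> x" for x
          proof (cases "x \<in> {e, f}")
            case True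
            then show ?thesis using B E by (auto simp: B_def PiE_def extensional_def)
          next
            case False
            then show ?thesis using fun_cong[OF eq(1), of x] by auto
          qed
          then show "p = q"
            using fun_cong[OF eq(1), of e] fun_cong[OF eq(1), of f] E(4) eq(2) by (auto simp: p q)
        qed
        show "(\<lambda>((\<sigma>, Z), (i, j)). (\<sigma>(e := i, f := j), Z)) ` (SIGMA c : B. P c)
            \<subseteq> copies (insert f E) (parallel_extension e f F) n S"
        proof
          fix x assume "x \<in> (\<lambda>((\<sigma>, Z), (i, j)). (\<sigma>(e := i, f := j), Z)) ` (SIGMA c : B. P c)"
          then obtain \<sigma> Z i j where B: "(\<sigma>, Z) \<in> B" and p: "(i, j) \<in> P (\<sigma>, Z)"
            and x: "x = (\<sigma>(e := i, f := j), Z)" by auto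
          let ?\<rho> = "\<sigma>(e := i, f := j)"
          have i: "(\<sigma>(e := i), Z) \<in> copies E F n S" and j: "(\<sigma>(e := j), Z) \<in> copies E F n S" and "i \<noteq> j"
            using p by (auto simp: P_def N_def)
          have "(?\<rho>, Z) \<in> configurations (insert f E) n"
          proof -
            have \<sigma>_i: "(\<sigma>(e := i), Z) \<in> configurations E n" using i by (simp add: copies_def)
            have \<sigma>_j: "\<sigma>(e := j) \<in> E \<rightarrow>\<^sub>E {..<n}" "inj_on (\<sigma>(e := j)) E" "Z \<subseteq> {..<n} - (\<sigma>(e := j)) ` E"
              using j by (simp_all add: copies_def configurations_def)
            \<comment> \<open>The image \<open>j\<close> of \<open>f\<close> is fresh because
              sending \<open>e\<close> to \<open>j\<close> is itself a configuration:
              \<open>j\<close> avoids \<open>Z\<close> and the images of the other edges, and it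
              differs from \<open>i\<close>.\<close>
            have "j < n" "j \<notin> Z" using PiE_mem[OF \<sigma>_j(1) assms(4)] \<sigma>_j(3) assms(4) by auto
            moreover have "j \<notin> (\<sigma>(e := i)) ` E"
            proof
              assume "j \<in> (\<sigma>(e := i)) ` E"
              then obtain x where "x \<in> E" "(\<sigma>(e := i)) x = j" by blast
              then show False using inj_onD[OF \<sigma>_j(2), of x e] assms(4) \<open>i \<noteq> j\<close>
                by (cases "x = e") auto
            qed
            ultimately show ?thesis using configurations_insert[OF \<sigma>_i assms(5)] by simp
          qed
          moreover have "Z \<union> ?\<rho> ` T \<in> S" if T: "T \<in> parallel_extension e f F" for T
          proof (cases "T \<in> F")
            case True
            then have "?\<rho> ` T = (\<sigma>(e := i)) ` T"
              using assms(3)[OF True] assms(5) by (intro image_cong) auto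
            then show ?thesis using i True by (auto simp: copies_def)
          next
            case False
            then obtain T' where T': "T = insert f (T' - {e})" "T' \<in> F" "e \<in> T'"
              using T by (auto simp: parallel_extension_def)
            have "?\<rho> ` T = (\<sigma>(e := j)) ` T'"
              using assms(3)[OF T'(2)] assms(5) T' by (auto simp: image_iff)
            then show ?thesis using j T' by (auto simp: copies_def)
          qed
          ultimately show "x \<in> copies (insert f E) (parallel_extension e f F) n S"
            by (simp add: copies_def x)
        qed
      qed (simp add: finite_copies assms)
      then have "(\<Sum>c\<in>B. card (P c)) \<le> card (copies (insert f E) (parallel_extension e f F) n S)"
        by (simp add: card_SigmaI P_def)
      then have "(\<Sum>c\<in>B. real (card (P c))) \<le> card (copies (insert f E) (parallel_extension e f F) n S)"
        by (simp flip: of_nat_sum)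
      ultimately have "M * a\<^sup>2 / 2 \<le> card (copies (insert f E) (parallel_extension e f F) n S)"
        by linarith
      then have "2 * C\<^sup>2 * (M * a\<^sup>2 / 2)
          \<le> 2 * C\<^sup>2 * card (copies (insert f E) (parallel_extension e f F) n S)"
        by (intro mult_left_mono) auto
      moreover have "2 * C\<^sup>2 * (M * a\<^sup>2 / 2) = \<delta> ^ (2 * k) * n ^ card (insert f E) * 2 ^ n"
      proof -
        have "2 * C\<^sup>2 * (M * a\<^sup>2 / 2) = M * (C * a)\<^sup>2" by (simp add: power_mult_distrib)
        also have "C * a = \<delta> ^ k * n" using Ck by (simp add: a_def)
        also have "M * (\<delta> ^ k * n)\<^sup>2 = \<delta> ^ (2 * k) * n ^ Suc (Suc (card E0)) * 2 ^ n"
          by (simp add: M_def power_mult_distrib power_even_eq) (simp add: power2_eq_square)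
        finally show ?thesis using assms(2,5) E(6) by simp
      qed
      ultimately show ?thesis by simp
    qed
  qed (use CC Ck in auto)
qed

text \<open>\<open>2 * card Z - n\<close> is a sum of \<open>n\<close> independent random signs,
  whose variance is \<open>n\<close>. In the induction the new element turns a deviation
  \<open>x\<close> into \<open>x - 1\<close> or \<open>x + 1\<close>, and the two squares add up to
  \<open>2 * x\<^sup>2 + 2\<close>.\<close>

lemma sum_square_deviation:
  "(\<Sum>Z\<in>Pow {..<n}. (2 * real (card Z) - n)\<^sup>2) = n * 2 ^ n"
proof (induction n)
  case (Suc n)
  have "(\<Sum>Z\<in>Pow {..<Suc n}. (2 * real (card Z) - Suc n)\<^sup>2)
      = (\<Sum>Z\<in>Pow {..<n}. (2 * real (card Z) - Suc n)\<^sup>2)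
        + (\<Sum>Z\<in>Pow {..<n}. (2 * real (card (insert n Z)) - Suc n)\<^sup>2)"
  proof -
    have "inj_on (insert n) (Pow {..<n})" by (rule inj_onI) auto
    then show ?thesis
      unfolding lessThan_Suc Pow_insert by (subst sum.union_disjoint) (auto simp: sum.reindex)
  qed
  also have "(\<Sum>Z\<in>Pow {..<n}. (2 * real (card (insert n Z)) - Suc n)\<^sup>2)
      = (\<Sum>Z\<in>Pow {..<n}. (2 * real (card Z) + 2 - Suc n)\<^sup>2)"
  proof (rule sum.cong[OF refl])
    fix Z assume "Z \<in> Pow {..<n}"
    then have "finite Z" "n \<notin> Z" using finite_subset by auto
    then show "(2 * real (card (insert n Z)) - Suc n)\<^sup>2 = (2 * real (card Z) + 2 - Suc n)\<^sup>2"
      by (simp add: algebra_simps)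
  qed
  also have "(\<Sum>Z\<in>Pow {..<n}. (2 * real (card Z) - Suc n)\<^sup>2) + \<dots>
      = (\<Sum>Z\<in>Pow {..<n}. 2 * (2 * real (card Z) - n)\<^sup>2 + 2)"
    by (subst sum.distrib[symmetric], rule sum.cong) (auto simp: power2_eq_square algebra_simps)
  also have "\<dots> = real (Suc n) * 2 ^ Suc n"
    unfolding sum.distrib sum_distrib_left[symmetric] Suc by (simp add: card_Pow algebra_simps)
  finally show ?case .
qed auto

text \<open>Chebyshev's inequality: \<open>5 * n < 8 * card Z\<close> forces a deviation
  \<open>2 * card Z - n\<close> above \<open>n / 4\<close>, hence the factor 16.\<close>

lemma card_large_subsets:
  "real n * card {Z \<in> Pow {..<n}. 5 * n < 8 * card Z} \<le> 16 * 2 ^ n"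
proof (cases "n = 0")
  case False
  let ?L = "{Z \<in> Pow {..<n}. 5 * n < 8 * card Z}"
  have "(\<Sum>Z\<in>?L. (real n / 4)\<^sup>2) \<le> (\<Sum>Z\<in>?L. (2 * real (card Z) - n)\<^sup>2)"
    by (intro sum_mono power_mono) auto
  also have "\<dots> \<le> (\<Sum>Z\<in>Pow {..<n}. (2 * real (card Z) - n)\<^sup>2)"
    by (intro sum_mono2) auto
  finally have "card ?L * (real n / 4)\<^sup>2 \<le> n * 2 ^ n"
    by (simp add: sum_square_deviation)
  then have "real n * (real n * card ?L) \<le> real n * (16 * 2 ^ n)"
    by (simp add: power2_eq_square algebra_simps)
  then show ?thesis using False by simp
qed auto

text \<open>
  A new coordinate at which every member of \<open>F\<close> is 0 may be sent to any coordinate outside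
  \<open>Z \<union> \<sigma> ` E\<close>. Few sets \<open>Z\<close> are so large that this leaves less than \<open>n / 4\<close> choices.
\<close>

lemma polynomially_dense_loop:
  assumes "polynomially_dense E F" "finite E" "\<And>T. T \<in> F \<Longrightarrow> T \<subseteq> E" "f \<notin> E"
  shows "polynomially_dense (insert f E) F"
proof -
  obtain C k where Ck: "C \<ge> 1" "k \<ge> 1"
    and dense: "\<And>n S \<delta>. S \<subseteq> Pow {..<n} \<Longrightarrow> real (card S) = \<delta> * 2 ^ n \<Longrightarrow> n = 0 \<or> C \<le> \<delta> ^ k * n \<Longrightarrow>
          \<delta> ^ k * n ^ card E * 2 ^ n \<le> C * card (copies E F n S)"
    using assms(1) unfolding polynomially_dense_def by blast
  let ?d = "card E"
  show ?thesis
  \<comment> \<open>The summand \<open>32 * C\<close> makes the copies with large \<open>Z\<close>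
    at most half of the guaranteed number. The summand \<open>8 * ?d\<close> gives
    \<open>?d \<le> n / 8\<close>, so that a set \<open>Z\<close> of at most
    \<open>5 * n / 8\<close> elements leaves \<open>3 * n / 8 - n / 8 = n / 4\<close> positions. The
    final loss is \<open>8 * C\<close>: a factor 2 for the discarded copies and 4 for the
    positions.\<close>
  proof (rule polynomially_denseI[of "32 * C + 8 * ?d" k])
    fix n S and \<delta> :: real
    assume S: "S \<subseteq> Pow {..<n}" "real (card S) = \<delta> * 2 ^ n" and \<delta>: "0 \<le> \<delta>" "\<delta> \<le> 1"
      and *: "n = 0 \<or> 32 * C + 8 * ?d \<le> \<delta> ^ k * n"
    show "\<delta> ^ k * n ^ card (insert f E) * 2 ^ n
        \<le> (32 * C + 8 * ?d) * card (copies (insert f E) F n S)"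
    proof (cases "n = 0")
      case True
      then show ?thesis using assms(2) Ck by (simp add: power_0_left card_gt_0_iff)
    next
      case False
      with * have n: "32 * C + 8 * ?d \<le> \<delta> ^ k * n" by simp
      have "\<delta> ^ k * n \<le> 1 * real n" using \<delta> by (intro mult_right_mono power_le_one) auto
      then have nd: "8 * ?d \<le> n" using n Ck by linarith
      define L where "L = {(\<sigma>, Z) \<in> copies E F n S. 5 * n < 8 * card Z}"
      have "finite L" by (rule finite_subset[OF _ finite_copies[of E F n S]]) (auto simp: L_def assms)
      have "card L \<le> card ((E \<rightarrow>\<^sub>E {..<n}) \<times> {Z \<in> Pow {..<n}. 5 * n < 8 * card Z})"
        by (rule card_mono) (auto simp: L_def copies_def configurations_def finite_PiE assms)
      also have "\<dots> = n ^ ?d * card {Z \<in> Pow {..<n}. 5 * n < 8 * card Z}"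
        by (simp add: card_cartesian_product card_PiE assms)
      finally have "real (card L) \<le> n ^ ?d * card {Z \<in> Pow {..<n}. 5 * n < 8 * card Z}"
        by (metis of_nat_le_iff)
      then have "real n * card L \<le> real n * (n ^ ?d * card {Z \<in> Pow {..<n}. 5 * n < 8 * card Z})"
        by (simp add: mult_left_mono)
      also have "\<dots> = n ^ ?d * (real n * card {Z \<in> Pow {..<n}. 5 * n < 8 * card Z})" by simp
      also have "\<dots> \<le> n ^ ?d * (16 * 2 ^ n :: real)"
        by (intro mult_left_mono card_large_subsets) auto
      finally have L: "real n * card L \<le> 16 * (n ^ ?d * 2 ^ n)" by simp
      have A: "\<delta> ^ k * n ^ ?d * 2 ^ n \<le> C * card (copies E F n S)"
      proof (rule dense[OF S])
        show "n = 0 \<or> C \<le> \<delta> ^ k * n" using n Ck by linarith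
      qed
      have L2: "2 * C * card L \<le> \<delta> ^ k * n ^ ?d * 2 ^ n"
      proof -
        have "2 * C * (real n * card L) \<le> 2 * C * (16 * (n ^ ?d * 2 ^ n))"
          using Ck by (intro mult_left_mono L) auto
        also have "\<dots> = 32 * C * (n ^ ?d * 2 ^ n)" by simp
        also have "\<dots> \<le> (\<delta> ^ k * n) * (n ^ ?d * 2 ^ n)"
          using n by (intro mult_right_mono) auto
        finally have "real n * (2 * C * card L) \<le> real n * (\<delta> ^ k * n ^ ?d * 2 ^ n)"
          by (simp add: algebra_simps)
        then show ?thesis using False by simp
      qed
      let ?N = "\<lambda>(\<sigma> :: 'a \<Rightarrow> nat, Z). {..<n} - Z - \<sigma> ` E"
      have "card (SIGMA c : copies E F n S - L. ?N c) \<le> card (copies (insert f E) F n S)"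
      proof (rule card_inj_on_le[where f = "\<lambda>((\<sigma>, Z), i). (\<sigma>(f := i), Z)"])
        show "inj_on (\<lambda>((\<sigma>, Z), i). (\<sigma>(f := i), Z)) (SIGMA c : copies E F n S - L. ?N c)"
        proof (rule inj_onI)
          fix p q assume pq: "p \<in> (SIGMA c : copies E F n S - L. ?N c)" "q \<in> (SIGMA c : copies E F n S - L. ?N c)"
            "(\<lambda>((\<sigma>, Z), i). (\<sigma>(f := i), Z)) p = (\<lambda>((\<sigma>, Z), i). (\<sigma>(f := i), Z)) q"
          obtain \<sigma> Z i where p: "p = ((\<sigma>, Z), i)" by (metis surj_pair)
          obtain \<tau> Z' i' where q: "q = ((\<tau>, Z'), i')" by (metis surj_pair)
          have B: "(\<sigma>, Z) \<in> copies E F n S" "(\<tau>, Z') \<in> copies E F n S"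
            and eq: "\<sigma>(f := i) = \<tau>(f := i')" "Z = Z'"
            using pq by (simp_all add: p q)
          \<comment> \<open>Overwriting the value at \<open>f\<close> loses no information, since
            extensional functions on \<open>E\<close> share one default value there.\<close>
          have "\<sigma> f = undefined" "\<tau> f = undefined" using B assms(4)
            by (auto simp: copies_def configurations_def PiE_def extensional_def)
          then have "\<sigma> x = \<tau> x" for x
            using fun_cong[OF eq(1), of x] by (cases "x = f") auto
          then show "p = q" using fun_cong[OF eq(1), of f] eq(2) by (auto simp: p q)
        qed
        show "(\<lambda>((\<sigma>, Z), i). (\<sigma>(f := i), Z)) ` (SIGMA c : copies E F n S - L. ?N c)
            \<subseteq> copies (insert f E) F n S"
        proof
          fix x assume "x \<in> (\<lambda>((\<sigma>, Z), i). (\<sigma>(f := i), Z)) ` (SIGMA c : copies E F n S - L. ?N c)"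
          then obtain \<sigma> Z i where c: "(\<sigma>, Z) \<in> copies E F n S" and i: "i < n" "i \<notin> Z" "i \<notin> \<sigma> ` E"
            and x: "x = (\<sigma>(f := i), Z)" by auto
          have "(\<sigma>(f := i), Z) \<in> configurations (insert f E) n"
            using c i assms(4) by (intro configurations_insert) (auto simp: copies_def)
          moreover have "(\<sigma>(f := i)) ` T = \<sigma> ` T" if "T \<in> F" for T
            using assms(3)[OF that] assms(4) by (intro image_cong) auto
          ultimately show "x \<in> copies (insert f E) F n S"
            using c by (auto simp: copies_def x)
        qed
      qed (simp add: finite_copies assms)
      moreover have "card (SIGMA c : copies E F n S - L. ?N c) = (\<Sum>c\<in>copies E F n S - L. card (?N c))"
        by (intro card_SigmaI) (auto simp: finite_copies assms)
      moreover have "(\<Sum>c\<in>copies E F n S - L. real n / 4) \<le> (\<Sum>c\<in>copies E F n S - L. real (card (?N c)))"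
      proof (intro sum_mono, clarify)
        fix \<sigma> Z assume c: "(\<sigma>, Z) \<in> copies E F n S" "(\<sigma>, Z) \<notin> L"
        then have Z: "Z \<subseteq> {..<n}" "8 * card Z \<le> 5 * n"
          by (auto simp: L_def copies_def configurations_def)
        have "card {..<n} - card Z - card (\<sigma> ` E) \<le> card ({..<n} - Z - \<sigma> ` E)"
          by (rule order_trans[OF _ diff_card_le_card_Diff])
             (use diff_card_le_card_Diff[of Z "{..<n}"] finite_subset[OF Z(1)] assms(2) in auto)
        moreover have "card (\<sigma> ` E) \<le> ?d" by (rule card_image_le[OF assms(2)])
        ultimately have "2 * n \<le> 8 * card ({..<n} - Z - \<sigma> ` E)" using Z(2) nd by simp
        then show "real n / 4 \<le> card ({..<n} - Z - \<sigma> ` E)" by linarith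
      qed
      ultimately have "card (copies E F n S - L) * (real n / 4) \<le> card (copies (insert f E) F n S)"
        by (simp flip: of_nat_sum)
      then have "4 * (2 * C) * (card (copies E F n S - L) * (real n / 4))
          \<le> 4 * (2 * C) * card (copies (insert f E) F n S)"
        using Ck by (intro mult_left_mono) auto
      moreover have "4 * (2 * C) * (card (copies E F n S - L) * (real n / 4))
          = n * (2 * C * card (copies E F n S - L))" by simp
      moreover have "\<delta> ^ k * n ^ ?d * 2 ^ n \<le> 2 * C * card (copies E F n S - L)"
      proof -
        have sub: "L \<subseteq> copies E F n S" by (auto simp: L_def)
        have diff: "real (card (copies E F n S - L)) = real (card (copies E F n S)) - real (card L)"
          using card_Diff_subset[OF \<open>finite L\<close> sub] card_mono[OF finite_copies[OF assms(2)] sub]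
          by (simp add: of_nat_diff)
        have "2 * C * card (copies E F n S - L) = 2 * (C * card (copies E F n S)) - 2 * C * card L"
          unfolding diff by (simp add: right_diff_distrib)
        then show ?thesis using A L2 by linarith
      qed
      then have "n * (\<delta> ^ k * n ^ ?d * 2 ^ n) \<le> n * (2 * C * card (copies E F n S - L))"
        by (intro mult_left_mono) auto
      moreover have "8 * C * card (copies (insert f E) F n S)
          \<le> (32 * C + 8 * ?d) * card (copies (insert f E) F n S)"
        using Ck by (intro mult_right_mono) auto
      ultimately show ?thesis using assms(2,4) by (simp add: algebra_simps)
    qed
  qed (use Ck in auto)
qed

section \<open>Series edges and bridges by complementation\<close>

definition series_extension :: "'e \<Rightarrow> 'e \<Rightarrow> 'e set set \<Rightarrow> 'e set set" where
  "series_extension e f F =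
     {insert f T |T. T \<in> F} \<union> {insert e T |T. T \<in> F \<and> e \<notin> T}"

text \<open>Dualise, extend in parallel, dualise again. The unchanged set \<open>E - T\<close> comes
  back as \<open>insert f T\<close>; if \<open>e \<notin> T\<close>, then exchanging
  \<open>e\<close> for \<open>f\<close> in \<open>E - T\<close> comes back as
  \<open>insert e T\<close>.\<close>

lemma polynomially_dense_series:
  assumes "polynomially_dense E F" "finite E" "\<And>T. T \<in> F \<Longrightarrow> T \<subseteq> E" "e \<in> E" "f \<notin> E"
  shows "polynomially_dense (insert f E) (series_extension e f F)"
proof -
  have "polynomially_dense E ((\<lambda>T. E - T) ` F)"
    by (rule polynomially_dense_dual[OF assms(1-3)])
  then have "polynomially_dense (insert f E) (parallel_extension e f ((\<lambda>T. E - T) ` F))"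
    by (rule polynomially_dense_parallel[OF _ assms(2) _ assms(4,5)]) auto
  then have "polynomially_dense (insert f E)
      ((\<lambda>T. insert f E - T) ` parallel_extension e f ((\<lambda>T. E - T) ` F))"
    by (rule polynomially_dense_dual) (use assms in \<open>auto simp: parallel_extension_def\<close>)
  moreover have "series_extension e f F
      \<subseteq> (\<lambda>T. insert f E - T) ` parallel_extension e f ((\<lambda>T. E - T) ` F)"
  proof
    fix U assume "U \<in> series_extension e f F"
    then consider T where "U = insert f T" "T \<in> F" | T where "U = insert e T" "T \<in> F" "e \<notin> T"
      by (auto simp: series_extension_def)
    then show "U \<in> (\<lambda>T. insert f E - T) ` parallel_extension e f ((\<lambda>T. E - T) ` F)"
    proof cases
      case 1
      then have "U = insert f E - (E - T)" using assms(3)[of T] assms(5) by auto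
      then show ?thesis using 1 by (auto simp: parallel_extension_def)
    next
      case 2
      have "U = insert f E - insert f (E - T - {e})" using 2 assms(3)[of T] assms(4,5) by auto
      moreover have "insert f (E - T - {e}) \<in> parallel_extension e f ((\<lambda>T. E - T) ` F)"
        unfolding parallel_extension_def using 2 assms(4) by blast
      ultimately show ?thesis by blast
    qed
  qed
  ultimately show ?thesis using assms(2) by (blast intro: polynomially_dense_mono)
qed

lemma polynomially_dense_bridge:
  assumes "polynomially_dense E F" "finite E" "\<And>T. T \<in> F \<Longrightarrow> T \<subseteq> E" "f \<notin> E"
  shows "polynomially_dense (insert f E) (insert f ` F)"
proof -
  have "polynomially_dense E ((\<lambda>T. E - T) ` F)"
    by (rule polynomially_dense_dual[OF assms(1-3)])
  then have "polynomially_dense (insert f E) ((\<lambda>T. E - T) ` F)"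
    by (rule polynomially_dense_loop[OF _ assms(2) _ assms(4)]) auto
  then have "polynomially_dense (insert f E) ((\<lambda>T. insert f E - T) ` (\<lambda>T. E - T) ` F)"
    by (rule polynomially_dense_dual) (use assms in auto)
  moreover have "insert f ` F \<subseteq> (\<lambda>T. insert f E - T) ` (\<lambda>T. E - T) ` F"
  proof
    fix U assume "U \<in> insert f ` F"
    then obtain T where T: "T \<in> F" "U = insert f T" by auto
    then have "U = insert f E - (E - T)" using assms(3)[of T] assms(4) by auto
    then show "U \<in> (\<lambda>T. insert f E - T) ` (\<lambda>T. E - T) ` F" using T by blast
  qed
  ultimately show ?thesis using assms(2) by (blast intro: polynomially_dense_mono)
qed

section \<open>Simple graphs without a \<open>K4\<close> minor\<close>

definition connected_in :: "('v \<times> 'v) set \<Rightarrow> 'v set \<Rightarrow> bool" where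
  "connected_in R B \<longleftrightarrow> B \<noteq> {} \<and> (\<forall>x\<in>B. \<forall>y\<in>B. (x, y) \<in> (R \<inter> B \<times> B)\<^sup>*)"

text \<open>A \<open>K4\<close> minor seen through adjacency alone: branch sets without named edges,
  so that the extremal argument can treat graphs as relations.\<close>

definition K4_model :: "'v set \<Rightarrow> ('v \<times> 'v) set \<Rightarrow> (nat \<Rightarrow> 'v set) \<Rightarrow> bool" where
  "K4_model V R B \<longleftrightarrow>
     (\<forall>i<4. B i \<subseteq> V \<and> connected_in R (B i)) \<and>
     (\<forall>i<4. \<forall>j<4. i \<noteq> j \<longrightarrow> B i \<inter> B j = {} \<and> (\<exists>a\<in>B i. \<exists>b\<in>B j. (a, b) \<in> R))"

lemma K4_model_mono:
  assumes "K4_model V R B" "V \<subseteq> V'" "R \<subseteq> R'"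
  shows "K4_model V' R' B"
proof -
  have "(R \<inter> B i \<times> B i)\<^sup>* \<subseteq> (R' \<inter> B i \<times> B i)\<^sup>*" for i
    using assms(3) by (intro rtrancl_mono) auto
  then show ?thesis
    using assms unfolding K4_model_def connected_in_def by (meson subset_iff)
qed

lemma K4_model_clique:
  assumes "sym R" "distinct [a, b, c, d]" "{a, b, c, d} \<subseteq> V"
    and "(a, b) \<in> R" "(a, c) \<in> R" "(a, d) \<in> R" "(b, c) \<in> R" "(b, d) \<in> R" "(c, d) \<in> R"
  shows "\<exists>B. K4_model V R B"
proof
  have 4: "i < 4 \<longleftrightarrow> i = 0 \<or> i = 1 \<or> i = 2 \<or> i = 3" for i :: nat by auto
  have "(b, a) \<in> R" "(c, a) \<in> R" "(d, a) \<in> R" "(c, b) \<in> R" "(d, b) \<in> R" "(d, c) \<in> R"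
    using assms by (auto dest: symD)
  then show "K4_model V R (\<lambda>i. {[a, b, c, d] ! i})"
    using assms unfolding K4_model_def connected_in_def 4 by (auto simp: eval_nat_numeral)
qed

section \<open>Contracting an edge of a simple graph\<close>

definition merge :: "'v \<Rightarrow> 'v \<Rightarrow> 'v \<Rightarrow> 'v" where
  "merge u w x = (if x = u then w else x)"

text \<open>The merged vertex keeps the name \<open>w\<close>. Loops are dropped and parallel edges
  coincide in a relation, so the result is simple again.\<close>

definition contraction :: "'v \<Rightarrow> 'v \<Rightarrow> ('v \<times> 'v) set \<Rightarrow> ('v \<times> 'v) set" where
  "contraction u w R = {(merge u w x, merge u w y) |x y. (x, y) \<in> R \<and> merge u w x \<noteq> merge u w y}"

lemma contractionI:
  "(x, y) \<in> R \<Longrightarrow> merge u w x \<noteq> merge u w y \<Longrightarrow> (merge u w x, merge u w y) \<in> contraction u w R"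
  by (auto simp: contraction_def)

text \<open>Put \<open>u\<close> into the branch set that contains \<open>w\<close>, if there is
  one. The new branch sets are the preimages under \<open>merge u w\<close>; paths lift because the
  only two vertices that are merged are adjacent.\<close>

lemma K4_model_contraction:
  assumes "K4_model (V - {u}) (contraction u w R) B" "sym R" "(u, w) \<in> R" "u \<in> V" "u \<noteq> w"
  shows "\<exists>B. K4_model V R B"
proof
  define B' where "B' = (\<lambda>i. if w \<in> B i then insert u (B i) else B i)"
  have B: "B i \<subseteq> V - {u}" "B i \<noteq> {}"
    "\<And>x y. x \<in> B i \<Longrightarrow> y \<in> B i \<Longrightarrow> (x, y) \<in> (contraction u w R \<inter> B i \<times> B i)\<^sup>*" if "i < 4" for i
    using assms(1) that by (auto simp: K4_model_def connected_in_def)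
  have mem: "x \<in> B' i \<longleftrightarrow> merge u w x \<in> B i" if "i < 4" for x i
    using B(1)[OF that] assms(5) by (auto simp: B'_def merge_def)
  have lift: "(x, y) \<in> (R \<inter> B' i \<times> B' i)\<^sup>*" if "merge u w x = merge u w y" "x \<in> B' i" "y \<in> B' i" "i < 4" for x y i
  proof (cases "x = y")
    case False
    then have "(x, y) = (u, w) \<or> (x, y) = (w, u)" using that(1) by (auto simp: merge_def split: if_splits)
    then have "(x, y) \<in> R" using assms(2,3) by (auto dest: symD)
    then show ?thesis using that by auto
  qed auto
  have conn: "connected_in R (B' i)" if i: "i < 4" for i
    unfolding connected_in_def
  proof (intro conjI ballI)
    show "B' i \<noteq> {}" using B(2)[OF i] by (auto simp: B'_def)
    fix x y assume x: "x \<in> B' i" and y: "y \<in> B' i"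
    have "(merge u w x, merge u w y) \<in> (contraction u w R \<inter> B i \<times> B i)\<^sup>*"
      using B(3)[OF i] x y mem[OF i] by auto
    \<comment> \<open>A lifted edge may leave from a different preimage than the one where the
      previous edge arrived, so the induction reaches all preimages of the current vertex.\<close>
    then have "\<forall>z. z \<in> B' i \<and> merge u w z = merge u w y \<longrightarrow> (x, z) \<in> (R \<inter> B' i \<times> B' i)\<^sup>*"
      if "q = merge u w y" for q using y that
    proof (induction "merge u w y" arbitrary: y q rule: rtrancl_induct)
      case base
      then show ?case using lift[OF _ x _ i] by auto
    next
      case (step p)
      then obtain p' q' where pq: "(p', q') \<in> R" "p = merge u w p'" "merge u w y = merge u w q'" "p \<in> B i"
          "merge u w y \<in> B i"
        by (auto simp: contraction_def)
      have p': "p' \<in> B' i" "q' \<in> B' i" using pq mem[OF i] by auto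
      have "(x, p') \<in> (R \<inter> B' i \<times> B' i)\<^sup>*"
        using step(3)[of p' p] pq p' by auto
      then have "(x, q') \<in> (R \<inter> B' i \<times> B' i)\<^sup>*"
        using pq(1) p' by (meson IntI SigmaI rtrancl.rtrancl_into_rtrancl)
      then show ?case
        using lift[OF _ p'(2) _ i] pq(3) by (metis rtrancl_trans)
    qed
    then show "(x, y) \<in> (R \<inter> B' i \<times> B' i)\<^sup>*" using y by auto
  qed
  show "K4_model V R B'"
    unfolding K4_model_def
  proof (intro conjI allI impI)
    fix i :: nat assume i: "i < 4"
    show "B' i \<subseteq> V" using B(1)[OF i] assms(4) by (auto simp: B'_def)
    show "connected_in R (B' i)" by (rule conn[OF i])
    fix j :: nat assume j: "j < 4" "i \<noteq> j"
    have ij: "B i \<inter> B j = {}" "\<exists>a\<in>B i. \<exists>b\<in>B j. (a, b) \<in> contraction u w R"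
      using assms(1) i j by (auto simp: K4_model_def)
    show "B' i \<inter> B' j = {}" using ij(1) mem[OF i] mem[OF j(1)] by auto
    show "\<exists>a\<in>B' i. \<exists>b\<in>B' j. (a, b) \<in> R"
      using ij(2) mem[OF i] mem[OF j(1)] by (auto simp: contraction_def)
  qed
qed

definition simple_graph :: "'v set \<Rightarrow> ('v \<times> 'v) set \<Rightarrow> bool" where
  "simple_graph V R \<longleftrightarrow> finite V \<and> R \<subseteq> V \<times> V \<and> sym R \<and> irrefl R"

lemma simple_graph_delete: "simple_graph V R \<Longrightarrow> simple_graph (V - U) (R \<inter> (V - U) \<times> (V - U))"
  by (auto simp: simple_graph_def sym_def irrefl_def)

lemma simple_graph_contraction:
  assumes "simple_graph V R" "w \<in> V" "u \<noteq> w"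
  shows "simple_graph (V - {u}) (contraction u w R)"
proof -
  have "sym (contraction u w R)"
  proof (rule symI)
    fix p q assume "(p, q) \<in> contraction u w R"
    then obtain x y where "(x, y) \<in> R" "p = merge u w x" "q = merge u w y" "p \<noteq> q"
      by (auto simp: contraction_def)
    moreover from this have "(y, x) \<in> R"
      using assms(1) by (auto simp: simple_graph_def dest: symD)
    ultimately have "(y, x) \<in> R" "q = merge u w y" "p = merge u w x" "q \<noteq> p" by auto
    then show "(q, p) \<in> contraction u w R" by (simp add: contractionI)
  qed
  moreover have "contraction u w R \<subseteq> (V - {u}) \<times> (V - {u})"
    using assms unfolding contraction_def simple_graph_def merge_def by auto
  ultimately show ?thesis
    using assms(1) by (auto simp: simple_graph_def irrefl_def contraction_def)
qed

lemma contraction_neighbours: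
  assumes "x \<noteq> u" "x \<noteq> w"
  shows "contraction u w R `` {x} = merge u w ` (R `` {x}) - {x}"
  using assms by (auto simp: contraction_def merge_def image_iff split: if_splits)

text \<open>\<open>merge u w\<close> identifies only \<open>u\<close> and \<open>w\<close>, so two
  neighbours of \<open>x\<close> collapse only if both of them occur.\<close>

lemma card_contraction_neighbours:
  assumes "simple_graph V R" "x \<noteq> u" "x \<noteq> w" "\<not> ((x, u) \<in> R \<and> (x, w) \<in> R)"
  shows "card (contraction u w R `` {x}) = card (R `` {x})"
proof -
  have "(x, x) \<notin> R" using assms(1) by (auto simp: simple_graph_def irrefl_def)
  then have "merge u w ` (R `` {x}) - {x} = merge u w ` (R `` {x})"
    using assms(2,3) by (auto simp: merge_def split: if_splits)
  moreover have "inj_on (merge u w) (R `` {x})"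
    using assms(4) by (auto simp: inj_on_def merge_def)
  ultimately show ?thesis using contraction_neighbours[OF assms(2,3)] by (simp add: card_image)
qed

lemma card_contraction_neighbours_common:
  assumes "simple_graph V R" "x \<noteq> u" "x \<noteq> w"
  shows "card (R `` {x}) - 1 \<le> card (contraction u w R `` {x})"
proof -
  have x: "(x, x) \<notin> R" "finite (R `` {x})"
    using assms(1) by (auto simp: simple_graph_def irrefl_def intro: finite_subset)
  have "R `` {x} - {u} \<subseteq> contraction u w R `` {x}"
    using assms(2,3) x by (auto simp: contraction_neighbours[OF assms(2,3)] merge_def image_iff)
  moreover have "finite (contraction u w R `` {x})"
    using x by (simp add: contraction_neighbours[OF assms(2,3)])
  ultimately have "card (R `` {x} - {u}) \<le> card (contraction u w R `` {x})" by (rule card_mono[rotated])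
  moreover have "card (R `` {x}) - 1 \<le> card (R `` {x} - {u})"
    using diff_card_le_card_Diff[of "{u}" "R `` {x}"] by simp
  ultimately show ?thesis by simp
qed

lemma contraction_neighbours_target:
  assumes "simple_graph V R" "u \<noteq> w"
  shows "contraction u w R `` {w} = (R `` {w} - {u}) \<union> (R `` {u} - {w})"
proof -
  have irr: "(u, u) \<notin> R" "(w, w) \<notin> R" using assms(1) by (auto simp: simple_graph_def irrefl_def)
  have "y \<in> contraction u w R `` {w} \<longleftrightarrow> y \<in> merge u w ` (R `` {w} \<union> R `` {u}) - {w}" for y
  proof
    assume "y \<in> contraction u w R `` {w}"
    then obtain a b where "(a, b) \<in> R" "merge u w a = w" "y = merge u w b" "y \<noteq> w"
      by (auto simp: contraction_def)
    then show "y \<in> merge u w ` (R `` {w} \<union> R `` {u}) - {w}"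
      by (auto simp: merge_def split: if_splits)
  next
    assume "y \<in> merge u w ` (R `` {w} \<union> R `` {u}) - {w}"
    then obtain a b where "(a, b) \<in> R" "merge u w a = w" "y = merge u w b" "y \<noteq> w"
      using assms(2) by (auto simp: merge_def)
    then show "y \<in> contraction u w R `` {w}"
      by (force simp: contraction_def)
  qed
  then have "contraction u w R `` {w} = merge u w ` (R `` {w} \<union> R `` {u}) - {w}" by blast
  then show ?thesis using irr assms(2) by (auto simp: merge_def split: if_splits)
qed

lemma contraction_memI:
  "(x, y) \<in> R \<Longrightarrow> x \<noteq> u \<Longrightarrow> y \<noteq> u \<Longrightarrow> x \<noteq> y \<Longrightarrow> (x, y) \<in> contraction u w R"
  by (force simp: contraction_def merge_def)

section \<open>A vertex with at most two neighbours\<close>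

lemma card_3_obtain_third:
  assumes "card A = 3" "a \<in> A" "b \<in> A" "a \<noteq> b"
  obtains c where "A = {a, b, c}" "c \<noteq> a" "c \<noteq> b"
proof -
  have "finite A" using assms(1) card.infinite by fastforce
  then have "card (A - {a, b}) = 1" using assms by (simp add: card_Diff_subset)
  then obtain c where "A - {a, b} = {c}" by (auto simp: card_1_singleton_iff)
  then show ?thesis using assms that[of c] by auto
qed

text \<open>
  Induction on the number of vertices. Pick \<open>v \<sim> s\<close> and contract \<open>v\<close> into \<open>s\<close>. This fails to keep
  the degrees only if some \<open>u\<close> has neighbours \<open>s, v, w\<close> exactly. Contracting \<open>u\<close> into \<open>w\<close> then fails
  only if there is a \<open>K4\<close> on \<open>s, u, v, w\<close> or \<open>v\<close> has neighbours \<open>s, u, w\<close> exactly. In the last case,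
  if \<open>w\<close> has degree 3 it can be contracted into its third neighbour; otherwise replace \<open>u, v\<close> by the
  edge \<open>s w\<close>. The edge \<open>s t\<close> is needed: \<open>K4\<close> minus the edge \<open>s t\<close> has no \<open>K4\<close> minor.
\<close>

lemma K4_model_if_degrees_ge_3:
  assumes "simple_graph V R" "(s, t) \<in> R" "V - {s, t} \<noteq> {}"
    and "\<And>x. x \<in> V - {s, t} \<Longrightarrow> 3 \<le> card (R `` {x})"
  shows "\<exists>B. K4_model V R B"
  using assms
proof (induction "card V" arbitrary: V R s t rule: less_induct)
  case less
  note G = \<open>simple_graph V R\<close> and deg = less.prems(4)
  have V: "finite V" and R: "R \<subseteq> V \<times> V" and sym: "\<And>x y. (x, y) \<in> R \<Longrightarrow> (y, x) \<in> R"
    and irr: "\<And>x. (x, x) \<notin> R" and "sym R"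
    using G by (auto simp: simple_graph_def irrefl_def dest: symD)
  have fin: "finite (R `` {x})" for x using R V by (auto intro: finite_subset)
  have st: "s \<in> V" "t \<in> V" "s \<noteq> t" using less.prems(2) R irr by auto
  \<comment> \<open>Removing \<open>U\<close> leaves all degrees outside the new exempt edge
    \<open>s' t'\<close> untouched, because no such vertex has a neighbour in \<open>U\<close>. The
    condition \<open>cover\<close> ensures that none of these vertices was exempt before.\<close>
  have delete: ?case
    if "U \<subseteq> V" "U \<noteq> {}" "s' \<in> V - U" "t' \<in> V - U" "(s', t') \<in> R" "V - U - {s', t'} \<noteq> {}"
      and isol: "\<And>x y. x \<in> V - U - {s', t'} \<Longrightarrow> y \<in> U \<Longrightarrow> (x, y) \<notin> R"
      and cover: "{s, t} \<subseteq> U \<union> {s', t'}" for U s' t'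
  proof -
    let ?R = "R \<inter> (V - U) \<times> (V - U)"
    have "card (V - U) < card V" using that(1,2) V by (intro psubset_card_mono) auto
    moreover have "3 \<le> card (?R `` {x})" if x: "x \<in> V - U - {s', t'}" for x
    proof -
      have "?R `` {x} = R `` {x}" using x isol R by auto
      then show ?thesis using deg[of x] x cover by auto
    qed
    ultimately have "\<exists>B. K4_model (V - U) ?R B"
      using less.hyps[OF _ simple_graph_delete[OF G, of U], of s' t'] that by auto
    then show ?thesis using K4_model_mono[of "V - U" ?R _ V R] by auto
  qed
  \<comment> \<open>This supplies the neighbour \<open>v\<close> of \<open>s\<close>. If
    \<open>s'\<close> sees nothing but \<open>t'\<close>, then either delete \<open>s'\<close> and
    exempt an edge at \<open>t'\<close>, or both ends are cut off from the rest and can be deleted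
    together in favour of any other edge.\<close>
  have isolated: ?case if "{s', t'} = {s, t}" "\<And>c. c \<in> V - {s, t} \<Longrightarrow> (s', c) \<notin> R" for s' t'
  proof (cases "\<exists>c\<in>V - {s, t}. (t', c) \<in> R")
    case True
    then obtain c where c: "c \<in> V - {s, t}" "(t', c) \<in> R" by auto
    have "\<not> R `` {c} \<subseteq> {s, t}"
      using deg[OF c(1)] card_mono[of "{s, t}" "R `` {c}"] st by auto
    then obtain c' where c': "(c, c') \<in> R" "c' \<noteq> s" "c' \<noteq> t" by auto
    have "c' \<noteq> c" "c' \<in> V" using irr c' R by auto
    then show ?thesis
      using that st c c' by (intro delete[of "{s'}" t' c]) (auto simp: doubleton_eq_iff dest: sym)
  next
    case False
    have *: "(c, s) \<notin> R" "(c, t) \<notin> R" if "c \<in> V - {s, t}" for c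
      using False \<open>{s', t'} = {s, t}\<close> \<open>\<And>c. c \<in> V - {s, t} \<Longrightarrow> (s', c) \<notin> R\<close> that
      by (auto simp: doubleton_eq_iff dest: sym)
    obtain c where c: "c \<in> V - {s, t}" using less.prems(3) by auto
    obtain c' where c': "(c, c') \<in> R" using deg[OF c] by (cases "R `` {c} = {}") auto
    have "\<not> R `` {c} \<subseteq> {c, c'}"
      using deg[OF c(1)] card_mono[of "{c, c'}" "R `` {c}"] by (auto simp: card_insert_if split: if_splits)
    then obtain c'' where c'': "(c, c'') \<in> R" "c'' \<noteq> c" "c'' \<noteq> c'" by auto
    have "c' \<in> V" "c'' \<in> V" using c' c'' R by auto
    then show ?thesis
      using * st c c' c'' by (intro delete[of "{s, t}" c c']) auto
  qed
  have contract: ?case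
    if "u \<in> V - {s, t}" "w \<in> V" "(u, w) \<in> R" "V - {u} - {s, t} \<noteq> {}"
      "\<And>x. x \<in> V - {u} - {s, t} \<Longrightarrow> 3 \<le> card (contraction u w R `` {x})" for u w
  proof -
    have "u \<noteq> w" using that irr by auto
    have "card (V - {u}) < card V" using that(1) V by (intro psubset_card_mono) auto
    moreover have "(s, t) \<in> contraction u w R"
      using less.prems(2) that(1) st by (intro contraction_memI) auto
    ultimately have "\<exists>B. K4_model (V - {u}) (contraction u w R) B"
      using less.hyps[OF _ simple_graph_contraction[OF G \<open>w \<in> V\<close> \<open>u \<noteq> w\<close>]] that by auto
    then show ?thesis using K4_model_contraction \<open>sym R\<close> that \<open>u \<noteq> w\<close> by fast
  qed
  show ?case
  proof (rule ccontr)
    assume none: "\<not> ?case"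
    obtain v where v: "v \<in> V - {s, t}" "(s, v) \<in> R"
      using isolated[of s t] none by blast
    have "\<not> R `` {v} \<subseteq> {s, t}"
      using deg[OF v(1)] card_mono[of "{s, t}" "R `` {v}"] st by auto
    then have "V - {v} - {s, t} \<noteq> {}" using R irr by auto
    then obtain u where u: "u \<in> V - {v} - {s, t}" "card (contraction v s R `` {u}) < 3"
      using contract[of v s] v st sym none by (meson not_le)
    have us: "(u, v) \<in> R" "(u, s) \<in> R" "card (R `` {u}) = 3"
      using card_contraction_neighbours[OF G, of u v s] card_contraction_neighbours_common[OF G, of u v s]
        u deg[of u] by auto
    obtain w where Nu: "R `` {u} = {s, v, w}" and w: "w \<noteq> s" "w \<noteq> v"
      using card_3_obtain_third[OF us(3), of s v] us v by auto
    have uw: "(u, w) \<in> R" "w \<noteq> u" "w \<in> V" using Nu irr R by auto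
    have svu: "(v, s) \<in> R" "(s, u) \<in> R" "(v, u) \<in> R" "(w, u) \<in> R" "s \<noteq> v" "s \<noteq> u" "u \<noteq> v" "v \<in> V" "u \<in> V"
      using v us uw u by (auto dest: sym)
    have no_clique: "\<not> ((s, w) \<in> R \<and> (v, w) \<in> R)"
      using K4_model_clique[OF \<open>sym R\<close>, of s u v w V] none v us uw w svu st by auto
    have "V - {u} - {s, t} \<noteq> {}" using v u by auto
    moreover have "u \<in> V - {s, t}" using u by auto
    ultimately obtain x where x: "x \<in> V - {u} - {s, t}" "card (contraction u w R `` {x}) < 3"
      using contract[of u w] uw none by (meson not_le)
    \<comment> \<open>Contracting \<open>u\<close> takes \<open>u\<close> away from \<open>w\<close>
      but gives it \<open>s\<close> and \<open>v\<close>. The degree of \<open>w\<close> can fall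
      only if both were neighbours already, and then \<open>s, u, v, w\<close> form a
      \<open>K4\<close>.\<close>
    have "x \<noteq> w"
    proof
      assume [simp]: "x = w"
      have "contraction u w R `` {w} = (R `` {w} - {u}) \<union> {s, v}"
        using contraction_neighbours_target[OF G, of u w] uw Nu w by auto
      moreover have "card (R `` {w} - {u}) = card (R `` {w}) - 1" using svu by simp
      moreover have "3 \<le> card (R `` {w})" using deg[of w] x by auto
      moreover have "finite (R `` {w})" by (rule fin)
      ultimately have "card (R `` {w} - {u} \<union> {s, v}) \<le> card (R `` {w} - {u})"
        using x(2) by simp
      then have "R `` {w} - {u} \<union> {s, v} = R `` {w} - {u}"
        using fin[of w] by (intro card_seteq[symmetric]) auto
      then show False using no_clique sym by blast
    qed
    then have xu: "(x, u) \<in> R" "(x, w) \<in> R" "card (R `` {x}) = 3"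
      using card_contraction_neighbours[OF G, of x u w] card_contraction_neighbours_common[OF G, of x u w]
        x deg[of x] by auto
    have "x = v" using sym[OF xu(1)] Nu x \<open>x \<noteq> w\<close> by auto
    then have vw: "(v, w) \<in> R" "card (R `` {v}) = 3" using xu by auto
    have sw: "(s, w) \<notin> R" "(w, s) \<notin> R" using no_clique vw sym by auto
    have Nv: "R `` {v} = {s, u, w}"
      using vw svu w uw card_seteq[OF fin, of "{s, u, w}" v] by auto
    have "w \<noteq> t" using sw less.prems(2) by auto
    then have wV: "w \<in> V - {s, t}" using uw w by auto
    have only: "y = v \<or> y = s \<or> y = w" if "(y, u) \<in> R" for y using sym[OF that] Nu by auto
    have only': "y = u \<or> y = s \<or> y = w" if "(y, v) \<in> R" for y using sym[OF that] Nv by auto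
    show False
    proof (cases "card (R `` {w}) = 3")
      case True
      obtain z where Nw: "R `` {w} = {u, v, z}" and z: "z \<noteq> u" "z \<noteq> v"
        using card_3_obtain_third[OF True, of u v] svu sym[OF vw(1)] by auto
      have zw: "(w, z) \<in> R" "z \<noteq> w" "z \<in> V" "z \<noteq> s" using Nw irr R sw by auto
      \<comment> \<open>\<open>z\<close> loses \<open>w\<close> but gains \<open>u\<close> and
        \<open>v\<close>. Any other vertex would need both \<open>w\<close> and \<open>z\<close> as
        neighbours to lose degree, but the neighbours of \<open>w\<close> besides \<open>z\<close>
        are \<open>u\<close> and \<open>v\<close>, neither of which is adjacent to
        \<open>z\<close>.\<close>
      have "3 \<le> card (contraction w z R `` {y})" if y: "y \<in> V - {w} - {s, t}" for y
      proof (cases "y = z")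
        case True
        have "contraction w z R `` {z} = (R `` {z} - {w}) \<union> {u, v}"
          using contraction_neighbours_target[OF G, of w z] zw Nw z by auto
        moreover have "u \<notin> R `` {z}" "v \<notin> R `` {z}" using only[of z] only'[of z] z zw by auto
        moreover have "card (R `` {z} - {w}) = card (R `` {z}) - 1" using sym[OF zw(1)] by simp
        moreover have "3 \<le> card (R `` {z})" using deg[of z] y True by auto
        ultimately show ?thesis using True fin[of z] svu by simp
      next
        case False
        have "\<not> ((y, w) \<in> R \<and> (y, z) \<in> R)"
        proof
          assume "(y, w) \<in> R \<and> (y, z) \<in> R"
          then have "y = u \<or> y = v" "(y, z) \<in> R" using sym[of y w] Nw False by auto
          then show False using Nu Nv z zw by auto
        qed
        then show ?thesis
          using card_contraction_neighbours[OF G, of y w z] deg[of y] y False by auto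
      qed
      moreover have "V - {w} - {s, t} \<noteq> {}" using u uw by auto
      ultimately show False using contract[of w z] wV zw none by blast
    next
      case False
      \<comment> \<open>Contracting \<open>u\<close> into \<open>s\<close> creates the edge
        \<open>s w\<close>, after which \<open>v\<close> is deleted. Since \<open>w\<close> has
        degree at least 4, losing \<open>u, v\<close> and gaining \<open>s\<close> leaves it at
        least 3.\<close>
      let ?V = "V - {u} - {v}" and ?R = "contraction u s R \<inter> (V - {u} - {v}) \<times> (V - {u} - {v})"
      have "3 \<le> card (?R `` {y})" if y: "y \<in> ?V - {s, t}" for y
      proof (cases "y = w")
        case True
        have "?R `` {w} = (R `` {w} - {u, v}) \<union> {s}"
        proof -
          have "contraction u s R `` {w} = merge u s ` (R `` {w}) - {w}"
            using contraction_neighbours[of w u s] uw w by auto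
          also have "\<dots> = R `` {w} - {u} \<union> {s}"
            using svu irr w by (auto simp: merge_def image_iff split: if_splits)
          finally show ?thesis using R w svu st u v uw by auto
        qed
        moreover have "card (R `` {w} - {u, v}) = card (R `` {w}) - 2"
          using svu sym[OF vw(1)] by (simp add: card_Diff_subset)
        moreover have "4 \<le> card (R `` {w})" using False deg[OF wV] by auto
        ultimately show ?thesis using True fin[of w] sw by simp
      next
        case False
        have "(y, u) \<notin> R" "(y, v) \<notin> R" using only[of y] only'[of y] y False by auto
        then have "?R `` {y} = R `` {y}"
          using contraction_neighbours[of y u s] y R irr
          by (auto simp: merge_def image_iff split: if_splits)
        then show ?thesis using deg[of y] y by auto
      qed
      moreover have "simple_graph ?V ?R"
        using simple_graph_delete[OF simple_graph_contraction[OF G, of s u], of "{v}"] st svu by auto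
      moreover have "(s, t) \<in> ?R"
        using less.prems(2) st u v by (auto intro: contraction_memI)
      moreover have "?V - {s, t} \<noteq> {}" using wV uw w by auto
      moreover have "card ?V < card V" using svu V by (intro psubset_card_mono) auto
      ultimately have "\<exists>B. K4_model ?V ?R B" using less.hyps[of ?V ?R s t] by blast
      then have "\<exists>B. K4_model (V - {u}) (contraction u s R) B"
        using K4_model_mono[of ?V ?R _ "V - {u}" "contraction u s R"] by auto
      then show False
        using K4_model_contraction[OF _ \<open>sym R\<close> us(2)] svu none by blast
    qed
  qed
qed

text \<open>If all degrees were at least 3, any edge could serve as the exempt pair
  \<open>s t\<close>.\<close>

corollary exists_degree_le_2:
  assumes "simple_graph V R" "V \<noteq> {}" "\<nexists>B. K4_model V R B"
  shows "\<exists>v\<in>V. card (R `` {v}) \<le> 2"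
proof (rule ccontr)
  assume "\<not> ?thesis"
  then have deg: "3 \<le> card (R `` {x})" if "x \<in> V" for x using that by auto
  obtain s where s: "s \<in> V" using assms(2) by auto
  obtain t where t: "(s, t) \<in> R" using deg[OF s] by (cases "R `` {s} = {}") auto
  have "\<not> R `` {s} \<subseteq> {s, t}"
    using deg[OF s] card_mono[of "{s, t}" "R `` {s}"] by (auto simp: card_insert_if split: if_splits)
  then have "V - {s, t} \<noteq> {}" using assms(1) by (auto simp: simple_graph_def)
  then show False using K4_model_if_degrees_ge_3[OF assms(1) t] deg assms(3) by auto
qed

section \<open>Spanning trees as minimal connecting edge sets\<close>

definition link :: "('e \<Rightarrow> 'v set) \<Rightarrow> 'e set \<Rightarrow> ('v \<times> 'v) set" where
  "link en T = {(u, v). \<exists>e\<in>T. en e = {u, v}}"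

definition connects :: "'v set \<Rightarrow> ('e \<Rightarrow> 'v set) \<Rightarrow> 'e set \<Rightarrow> bool" where
  "connects V en T \<longleftrightarrow> (\<forall>u\<in>V. \<forall>v\<in>V. (u, v) \<in> (link en T)\<^sup>*)"

text \<open>Minimality takes the place of acyclicity, so the reductions never have to follow a
  cycle.\<close>

definition minimally_connects :: "'v set \<Rightarrow> ('e \<Rightarrow> 'v set) \<Rightarrow> 'e set \<Rightarrow> bool" where
  "minimally_connects V en T \<longleftrightarrow> connects V en T \<and> (\<forall>e\<in>T. \<not> connects V en (T - {e}))"

text \<open>Vertices, ends and edges are separate arguments, so that suppressing a vertex is a
  matter of \<open>V - {v}\<close> and an update of \<open>en\<close>.\<close>

definition trees :: "'v set \<Rightarrow> ('e \<Rightarrow> 'v set) \<Rightarrow> 'e set \<Rightarrow> 'e set set" where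
  "trees V en E = {T. T \<subseteq> E \<and> minimally_connects V en T}"

section \<open>Connectivity under deletion and contraction\<close>

lemma link_mono: "T \<subseteq> T' \<Longrightarrow> link en T \<subseteq> link en T'"
  by (auto simp: link_def)

lemma sym_link: "sym (link en T)"
  by (auto simp: sym_def link_def insert_commute)

lemma linkI: "e \<in> T \<Longrightarrow> en e = {u, v} \<Longrightarrow> (u, v) \<in> link en T"
  by (auto simp: link_def)

lemma linkE:
  assumes "(u, v) \<in> link en T"
  obtains e where "e \<in> T" "en e = {u, v}"
  using assms by (auto simp: link_def)

lemma link_image_cong: "en ` T = en ` T' \<Longrightarrow> link en T = link en T'"
  unfolding link_def by (auto simp: image_iff set_eq_iff) metis+

text \<open>The common engine of the reductions: a vertex map that sends edges to paths preserves
  connectivity. Deletions use the identity, contractions use \<open>merge\<close>.\<close>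

lemma connects_image:
  assumes "connects V en T" "V' \<subseteq> r ` V"
    and "\<And>x y. (x, y) \<in> link en T \<Longrightarrow> (r x, r y) \<in> (link en' T')\<^sup>*"
  shows "connects V' en' T'"
proof -
  have "(r x, r y) \<in> (link en' T')\<^sup>*" if "(x, y) \<in> (link en T)\<^sup>*" for x y
    using that by induction (auto intro: rtrancl_trans assms(3))
  then show ?thesis using assms(1,2) unfolding connects_def by blast
qed

lemma connects_mono: "connects V en T \<Longrightarrow> T \<subseteq> T' \<Longrightarrow> connects V en T'"
  by (rule connects_image[where r = id]) (auto dest: link_mono)

lemma connects_cong:
  assumes "\<And>e. e \<in> T \<Longrightarrow> en e = en' e"
  shows "connects V en T = connects V en' T"
  using assms by (simp add: connects_def link_def cong: bex_cong)

lemma minimally_connects_cong: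
  assumes "\<And>e. e \<in> T \<Longrightarrow> en e = en' e"
  shows "minimally_connects V en T = minimally_connects V en' T"
  using connects_cong[of T en en'] connects_cong[of "T - {_}" en en'] assms
  by (simp add: minimally_connects_def)

lemma connects_insert_vertex:
  assumes "connects (V - {v}) en T" "(v, w) \<in> link en T" "w \<in> V" "w \<noteq> v"
  shows "connects V en T"
proof -
  have w: "(w, v) \<in> link en T" using assms(2) sym_link[of en T] by (auto dest: symD)
  have "(x, w) \<in> (link en T)\<^sup>* \<and> (w, x) \<in> (link en T)\<^sup>*" if "x \<in> V" for x
    using assms w that by (cases "x = v") (auto simp: connects_def)
  then show ?thesis unfolding connects_def by (meson rtrancl_trans)
qed

lemma connects_edge_at:
  assumes "connects V en T" "v \<in> V" "w \<in> V" "v \<noteq> w"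
  obtains e where "e \<in> T" "v \<in> en e"
proof -
  have "(v, w) \<in> (link en T)\<^sup>*" using assms by (auto simp: connects_def)
  then obtain x where "(v, x) \<in> link en T" using assms(4) by (meson converse_rtranclE)
  then show ?thesis using that by (auto simp: link_def)
qed

lemma connects_delete_loop:
  assumes "connects V en T" "en e = {x}"
  shows "connects V en (T - {e})"
  using assms(1)
proof (rule connects_image[where r = id])
  fix y z assume "(y, z) \<in> link en T"
  then obtain g where g: "g \<in> T" "en g = {y, z}" by (rule linkE)
  show "(id y, id z) \<in> (link en (T - {e}))\<^sup>*"
  proof (cases "g = e")
    case True
    then have "y = z" using g assms(2) by (metis doubleton_eq_iff insert_absorb2)
    then show ?thesis by simp
  next
    case False
    then show ?thesis using g by (auto intro!: r_into_rtrancl linkI[of g])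
  qed
qed simp

lemma connects_delete_pendant:
  assumes "connects V en T" "en e = {v, w}" "w \<in> V" "v \<noteq> w" "\<And>g. g \<in> T \<Longrightarrow> v \<in> en g \<Longrightarrow> g = e"
  shows "connects (V - {v}) en (T - {e})"
  using assms(1)
proof (rule connects_image[where r = "merge v w"])
  show "V - {v} \<subseteq> merge v w ` V" by (auto simp: merge_def image_iff)
  fix y z assume "(y, z) \<in> link en T"
  then obtain g where g: "g \<in> T" "en g = {y, z}" by (rule linkE)
  show "(merge v w y, merge v w z) \<in> (link en (T - {e}))\<^sup>*"
  proof (cases "g = e")
    case True
    then have "merge v w y = merge v w z" using g assms(2) by (auto simp: merge_def doubleton_eq_iff)
    then show ?thesis by simp
  next
    case False
    then have "v \<noteq> y" "v \<noteq> z" using assms(5)[of g] g by auto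
    then show ?thesis using g False by (auto simp: merge_def intro!: r_into_rtrancl linkI[of g])
  qed
qed

lemma minimally_connects_delete_pendant:
  assumes "minimally_connects V en T" "en e = {v, w}" "v \<in> V" "w \<in> V" "v \<noteq> w"
    and "\<And>g. g \<in> T \<Longrightarrow> v \<in> en g \<Longrightarrow> g = e"
  shows "e \<in> T" "minimally_connects (V - {v}) en (T - {e})"
proof -
  have T: "connects V en T" using assms(1) by (simp add: minimally_connects_def)
  show e: "e \<in> T" using connects_edge_at[OF T assms(3-5)] assms(6) by metis
  have "\<not> connects (V - {v}) en (T - {e} - {g})" if g: "g \<in> T - {e}" for g
  proof
    assume "connects (V - {v}) en (T - {e} - {g})"
    then have "connects (V - {v}) en (T - {g})" by (rule connects_mono) auto
    moreover have "(v, w) \<in> link en (T - {g})" using e g assms(2) by (intro linkI[of e]) auto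
    ultimately have "connects V en (T - {g})" using assms(4,5) by (auto intro: connects_insert_vertex)
    then show False using assms(1) g by (auto simp: minimally_connects_def)
  qed
  then show "minimally_connects (V - {v}) en (T - {e})"
    using connects_delete_pendant[OF T assms(2,4,5,6)] by (simp add: minimally_connects_def)
qed

text \<open>Contracting \<open>v\<close> into \<open>a\<close> collapses \<open>e\<close> and turns
  \<open>f\<close> into an edge between \<open>a\<close> and \<open>b\<close>. The name
  \<open>e\<close> is reused for that edge, and \<open>f\<close> disappears.\<close>

lemma connects_contract_series:
  assumes "connects V en T" "e \<in> T" "en e = {v, a}" "en f = {v, b}" "e \<noteq> f" "a \<in> V" "v \<noteq> a" "v \<noteq> b"
    and "\<And>g. g \<in> T \<Longrightarrow> v \<in> en g \<Longrightarrow> g = e \<or> g = f"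
  shows "connects (V - {v}) (en(e := {a, b})) (T - {f})"
  using assms(1)
proof (rule connects_image[where r = "merge v a"])
  show "V - {v} \<subseteq> merge v a ` V" by (auto simp: merge_def image_iff)
  fix y z assume "(y, z) \<in> link en T"
  then obtain g where g: "g \<in> T" "en g = {y, z}" by (rule linkE)
  consider "g = e" | "g = f" | "g \<noteq> e" "g \<noteq> f" "v \<noteq> y" "v \<noteq> z" using assms(9)[of g] g by auto
  then show "(merge v a y, merge v a z) \<in> (link (en(e := {a, b})) (T - {f}))\<^sup>*"
  proof cases
    case 1
    then have "merge v a y = merge v a z" using g assms(3) by (auto simp: merge_def doubleton_eq_iff)
    then show ?thesis by simp
  next
    case 2
    then have "{merge v a y, merge v a z} = {a, b}"
      using g assms(4,8) by (auto simp: merge_def doubleton_eq_iff)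
    then show ?thesis using assms(2,5) by (intro r_into_rtrancl linkI[of e]) auto
  next
    case 3
    then have "(y, z) \<in> link (en(e := {a, b})) (T - {f})" using g by (intro linkI[of g]) auto
    then show ?thesis using 3 by (simp add: merge_def r_into_rtrancl)
  qed
qed

section \<open>Spanning trees under the four reductions\<close>

lemma trees_subset: "T \<in> trees V en E \<Longrightarrow> T \<subseteq> E"
  by (simp add: trees_def)

lemma trees_loop:
  assumes "en e = {x}"
  shows "trees V en E \<subseteq> trees V en (E - {e})"
  using connects_delete_loop[of V en _ e x] assms by (auto simp: trees_def minimally_connects_def)

text \<open>Connectivity depends only on the collection of end sets. Hence a minimal set never holds
  both edges, and one that holds \<open>f\<close> stays minimal when \<open>f\<close> is exchanged
  for \<open>e\<close>.\<close>

lemma trees_parallel: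
  assumes "en e = en f" "e \<noteq> f" "e \<in> E"
  shows "trees V en E \<subseteq> parallel_extension e f (trees V en (E - {f}))"
proof
  fix T assume T: "T \<in> trees V en E"
  have cong: "connects V en A = connects V en B" if "en ` A = en ` B" for A B
    using link_image_cong[OF that] by (simp add: connects_def)
  show "T \<in> parallel_extension e f (trees V en (E - {f}))"
  proof (cases "f \<in> T")
    case False
    then show ?thesis using T by (auto simp: parallel_extension_def trees_def)
  next
    case True
    have "e \<notin> T"
    proof
      assume "e \<in> T"
      then have "en ` T = en ` (T - {f})" using assms(1,2) by (auto simp: image_iff)
      then show False using T True cong[of T "T - {f}"] by (auto simp: trees_def minimally_connects_def)
    qed
    define T' where "T' = insert e (T - {f})"
    have "en ` T' = en ` T" using assms(1) True by (auto simp: T'_def)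
    moreover have "\<not> connects V en (T' - {g})" if "g \<in> T'" for g
    proof -
      \<comment> \<open>The edge of \<open>T\<close> that corresponds to \<open>g\<close> under the
        exchange; deleting \<open>g\<close> from \<open>T'\<close> or \<open>g'\<close> from
        \<open>T\<close> leaves the same end sets.\<close>
      define g' where "g' = (if g = e then f else g)"
      have "g' \<in> T" using that True by (auto simp: g'_def T'_def)
      moreover have "en ` (T' - {g}) = en ` (T - {g'})"
      proof (cases "g = e")
        case True
        then show ?thesis using \<open>e \<notin> T\<close> by (auto simp: g'_def T'_def)
      next
        case False
        then have "g \<noteq> f" using that assms(2) by (auto simp: T'_def)
        then have "T' - {g} = insert e (T - {g} - {f})" "T - {g} = insert f (T - {g} - {f})"
          using False True by (auto simp: T'_def)
        then show ?thesis using False assms(1) by (metis g'_def image_insert)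
      qed
      ultimately show ?thesis using T cong[of "T' - {g}" "T - {g'}"] by (auto simp: trees_def minimally_connects_def)
    qed
    ultimately have "T' \<in> trees V en (E - {f})"
      using T cong[of T' T] assms(2,3) by (auto simp: trees_def minimally_connects_def T'_def)
    moreover have "T = insert f (T' - {e})" "e \<in> T'" using True \<open>e \<notin> T\<close> by (auto simp: T'_def)
    ultimately show ?thesis by (auto simp: parallel_extension_def)
  qed
qed

lemma trees_pendant:
  assumes "en e = {v, w}" "v \<in> V" "w \<in> V" "v \<noteq> w" "\<And>g. g \<in> E \<Longrightarrow> v \<in> en g \<Longrightarrow> g = e"
  shows "trees V en E \<subseteq> insert e ` trees (V - {v}) en (E - {e})"
proof
  fix T assume T: "T \<in> trees V en E"
  then have "e \<in> T" "minimally_connects (V - {v}) en (T - {e})"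
    using minimally_connects_delete_pendant[of V en T e v w] assms by (auto simp: trees_def)
  then have "T - {e} \<in> trees (V - {v}) en (E - {e})" "T = insert e (T - {e})"
    using T by (auto simp: trees_def)
  then show "T \<in> insert e ` trees (V - {v}) en (E - {e})" by blast
qed

text \<open>If a tree uses both edges at \<open>v\<close>, contract one of them. If it uses only
  one, then \<open>v\<close> is pendant in the tree, and the rest contains neither \<open>e\<close>
  nor \<open>f\<close>, so that redirecting \<open>e\<close> does not affect it.\<close>

lemma trees_series:
  assumes e: "e \<in> E" "en e = {v, a}" and f: "f \<in> E" "en f = {v, b}" and "e \<noteq> f"
    and ab: "a \<in> V" "b \<in> V" "v \<in> V" "v \<noteq> a" "v \<noteq> b"
    and at_v: "\<And>g. g \<in> E \<Longrightarrow> v \<in> en g \<Longrightarrow> g = e \<or> g = f"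
  shows "trees V en E \<subseteq> series_extension e f (trees (V - {v}) (en(e := {a, b})) (E - {f}))"
proof
  fix T assume T: "T \<in> trees V en E"
  let ?en = "en(e := {a, b})"
  have TE: "T \<subseteq> E" and min: "minimally_connects V en T" and conn: "connects V en T"
    using T by (auto simp: trees_def minimally_connects_def)
  have pendant: "h \<in> T \<and> T - {h} \<in> trees (V - {v}) ?en (E - {f})"
    if h: "{h, h'} = {e, f}" "h' \<notin> T" "en h = {v, c}" "c \<in> V" "v \<noteq> c" for h h' c
  proof -
    have *: "g = h" if "g \<in> T" "v \<in> en g" for g using at_v[of g] that TE h by (auto simp: doubleton_eq_iff)
    note del = minimally_connects_delete_pendant[OF min h(3) ab(3) h(4,5) *]
    have "e \<notin> T - {h}" "f \<notin> T - {h}" using h by (auto simp: doubleton_eq_iff)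
    moreover from this have "minimally_connects (V - {v}) ?en (T - {h})"
      using minimally_connects_cong[of "T - {h}" en ?en "V - {v}"] del(2) by (metis fun_upd_other)
    ultimately show ?thesis using del TE by (auto simp: trees_def)
  qed
  consider "e \<in> T" "f \<in> T" | "e \<notin> T" | "f \<notin> T" by blast
  then show "T \<in> series_extension e f (trees (V - {v}) ?en (E - {f}))"
  proof cases
    case 1
    have "\<not> connects (V - {v}) ?en (T - {f} - {g})" if g: "g \<in> T - {f}" for g
    proof
      assume "connects (V - {v}) ?en (T - {f} - {g})"
      then have "connects (V - {v}) en (T - {g})"
      proof (rule connects_image[where r = id])
        fix y z assume "(y, z) \<in> link ?en (T - {f} - {g})"
        then obtain h where h: "h \<in> T - {f} - {g}" "?en h = {y, z}" by (rule linkE)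
        show "(id y, id z) \<in> (link en (T - {g}))\<^sup>*"
        proof (cases "h = e")
          case True
          have "(a, v) \<in> link en (T - {g})" "(v, b) \<in> link en (T - {g})"
            "(v, a) \<in> link en (T - {g})" "(b, v) \<in> link en (T - {g})"
            using h True 1 e f g by (auto intro: linkI[of e] linkI[of f])
          then have "(a, b) \<in> (link en (T - {g}))\<^sup>*" "(b, a) \<in> (link en (T - {g}))\<^sup>*"
            by (meson r_into_rtrancl rtrancl_trans)+
          then show ?thesis using h True by (auto simp: doubleton_eq_iff)
        next
          case False
          then show ?thesis using h by (auto intro!: r_into_rtrancl linkI[of h])
        qed
      qed simp
      moreover have "(v, b) \<in> link en (T - {g})" using 1 f g by (intro linkI[of f]) auto
      ultimately have "connects V en (T - {g})" using ab by (auto intro: connects_insert_vertex)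
      then show False using min g by (auto simp: minimally_connects_def)
    qed
    moreover have "connects (V - {v}) ?en (T - {f})"
      using connects_contract_series[OF conn 1(1) e(2) f(2) \<open>e \<noteq> f\<close> ab(1,4,5)] at_v TE by blast
    ultimately have "T - {f} \<in> trees (V - {v}) ?en (E - {f})"
      using TE by (auto simp: trees_def minimally_connects_def)
    moreover have "T = insert f (T - {f})" using 1 by auto
    ultimately show ?thesis unfolding series_extension_def by blast
  next
    case 2
    then have "f \<in> T" "T - {f} \<in> trees (V - {v}) ?en (E - {f})"
      using pendant[of f e b] f ab by auto
    moreover from this have "T = insert f (T - {f})" by auto
    ultimately show ?thesis unfolding series_extension_def by blast
  next
    case 3
    then have "e \<in> T" "T - {e} \<in> trees (V - {v}) ?en (E - {f})"
      using pendant[of e f a] e ab by auto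
    moreover from this have "T = insert e (T - {e})" by auto
    ultimately show ?thesis unfolding series_extension_def by blast
  qed
qed

text \<open>Loops and parallel edges are removed first. Afterwards the edges at a vertex correspond
  to its neighbours, so a vertex with at most two neighbours has at most two edges and is pendant or
  can be suppressed.\<close>

lemma polynomially_dense_trees:
  assumes "finite V" "V \<noteq> {}" "finite E" "\<And>e. e \<in> E \<Longrightarrow> en e \<subseteq> V \<and> card (en e) \<in> {1, 2}"
    and "connects V en E" "\<nexists>B. K4_model V (link en E) B"
  shows "polynomially_dense E (trees V en E)"
  using assms
proof (induction "card E" arbitrary: V E en rule: less_induct)
  case less
  note en = less.prems(4) and conn = less.prems(5) and no_K4 = less.prems(6)
  have smaller: "card (E - {e}) < card E" "finite (E - {e})" "E = insert e (E - {e})" if "e \<in> E" for e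
    using that less.prems(3) card_Diff1_less[of E e] by auto
  have no_K4': "\<nexists>B. K4_model V' (link en E') B" if "V' \<subseteq> V" "E' \<subseteq> E" for V' E'
    using no_K4 K4_model_mono[OF _ that(1) link_mono[OF that(2)]] by blast
  consider (empty) "E = {}"
    | (loop) e where "e \<in> E" "card (en e) = 1"
    | (parallel) e f where "e \<in> E" "f \<in> E" "e \<noteq> f" "en e = en f"
    | (simple) "E \<noteq> {}" "\<And>e. e \<in> E \<Longrightarrow> card (en e) = 2" "inj_on en E"
    using en unfolding inj_on_def by (metis empty_iff insert_iff)
  then show ?case
  proof cases
    case empty
    have "trees V en {} \<subseteq> {{}}" by (auto simp: trees_def)
    then show ?thesis using polynomially_dense_mono[OF polynomially_dense_empty] empty by auto
  next
    case loop
    then obtain x where x: "en e = {x}" by (auto simp: card_1_singleton_iff)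
    have "polynomially_dense (E - {e}) (trees V en (E - {e}))"
      using connects_delete_loop[OF conn x] less.prems no_K4'[of V "E - {e}"] smaller[OF loop(1)]
      by (intro less.hyps) auto
    then have "polynomially_dense (insert e (E - {e})) (trees V en (E - {e}))"
      using smaller(2)[OF loop(1)] by (intro polynomially_dense_loop) (auto dest: trees_subset)
    then show ?thesis
      using polynomially_dense_mono trees_loop[of en e x V E] x smaller[OF loop(1)] less.prems(3) by metis
  next
    case parallel
    have "en ` (E - {f}) = en ` E" using parallel by (auto simp: image_iff)
    then have "connects V en (E - {f})"
      using conn link_image_cong[of en "E - {f}" E] by (simp add: connects_def)
    then have "polynomially_dense (E - {f}) (trees V en (E - {f}))"
      using less.prems no_K4'[of V "E - {f}"] smaller[OF parallel(2)]
      by (intro less.hyps) auto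
    then have "polynomially_dense (insert f (E - {f})) (parallel_extension e f (trees V en (E - {f})))"
      using smaller[OF parallel(2)] parallel by (intro polynomially_dense_parallel) (auto dest: trees_subset)
    then show ?thesis
      using polynomially_dense_mono trees_parallel[OF parallel(4,3,1)] smaller[OF parallel(2)]
        less.prems(3) by metis
  next
    case simple
    let ?R = "link en E"
    have "simple_graph V ?R"
    proof -
      have "(x, y) \<in> ?R \<Longrightarrow> x \<noteq> y \<and> x \<in> V \<and> y \<in> V" for x y
      proof (erule linkE)
        fix e assume "e \<in> E" "en e = {x, y}"
        then show "x \<noteq> y \<and> x \<in> V \<and> y \<in> V" using simple(2)[of e] en[of e] by auto
      qed
      then show ?thesis using less.prems(1) sym_link[of en E] by (auto simp: simple_graph_def irrefl_def)
    qed
    then obtain v where v: "v \<in> V" "card (?R `` {v}) \<le> 2"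
      using exists_degree_le_2 less.prems(2) no_K4 by blast
    have "finite (?R `` {v})"
      using \<open>simple_graph V ?R\<close> by (auto simp: simple_graph_def intro: finite_subset)
    define I where "I = {e \<in> E. v \<in> en e}"
    have finI: "finite I" using less.prems(3) by (auto simp: I_def)
    have other: "\<exists>x. en e = {v, x} \<and> x \<noteq> v \<and> x \<in> V" if "e \<in> I" for e
    proof -
      have "card (en e) = 2" "v \<in> en e" using that simple(2) by (auto simp: I_def)
      then obtain x where "en e = {v, x}" "x \<noteq> v"
        by (metis card_2_iff doubleton_eq_iff insertE singletonD)
      then show ?thesis using en[of e] that by (auto simp: I_def)
    qed
    have "card I \<le> card ((\<lambda>x. {v, x}) ` (?R `` {v}))"
    proof (rule card_inj_on_le[of en])
      show "inj_on en I" using simple(3) by (auto simp: I_def inj_on_def)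
      show "en ` I \<subseteq> (\<lambda>x. {v, x}) ` (?R `` {v})"
      proof
        fix A assume "A \<in> en ` I"
        then obtain e where e: "e \<in> I" "A = en e" by auto
        then obtain x where "en e = {v, x}" using other by blast
        then show "A \<in> (\<lambda>x. {v, x}) ` (?R `` {v})" using e by (auto simp: I_def intro: linkI[of e])
      qed
    qed (use \<open>finite (?R `` {v})\<close> in simp)
    then have "card I \<le> 2"
      using card_image_le[OF \<open>finite (?R `` {v})\<close>, of "\<lambda>x. {v, x}"] v(2) by linarith
    \<comment> \<open>An edge that is not a loop provides a second vertex, so connectivity rules out
      an isolated \<open>v\<close>.\<close>
    moreover have "card I \<noteq> 0"
    proof
      assume "card I = 0"
      then have "I = {}" using finI by simp
      obtain g where g: "g \<in> E" using simple(1) by blast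
      obtain x y where "en g = {x, y}" using simple(2)[OF g] by (auto simp: card_2_iff)
      then have "x \<in> V" "x \<noteq> v" using en[OF g] \<open>I = {}\<close> g by (auto simp: I_def)
      then show False using connects_edge_at[OF conn v(1), of x] \<open>I = {}\<close> by (auto simp: I_def)
    qed
    ultimately consider "card I = 1" | "card I = 2" by linarith
    then show ?thesis
    proof cases
      case 1
      then obtain e where I: "I = {e}" by (auto simp: card_1_singleton_iff)
      then have e: "e \<in> E" by (auto simp: I_def)
      obtain w where w: "en e = {v, w}" "w \<noteq> v" "w \<in> V" using other[of e] I by auto
      have at_v: "g = e" if "g \<in> E" "v \<in> en g" for g using that I by (auto simp: I_def)
      have "polynomially_dense (E - {e}) (trees (V - {v}) en (E - {e}))"
        using connects_delete_pendant[OF conn w(1,3) w(2)[symmetric] at_v] less.prems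
          no_K4'[of "V - {v}" "E - {e}"] smaller[OF e] w at_v
        by (intro less.hyps) auto
      then have "polynomially_dense (insert e (E - {e})) (insert e ` trees (V - {v}) en (E - {e}))"
        using smaller[OF e] by (intro polynomially_dense_bridge) (auto dest: trees_subset)
      moreover have "trees V en E \<subseteq> insert e ` trees (V - {v}) en (E - {e})"
        using w v at_v by (intro trees_pendant[of en e v w]) auto
      ultimately show ?thesis
        using polynomially_dense_mono smaller[OF e] less.prems(3) by metis
    next
      case 2
      then obtain e f where I: "I = {e, f}" "e \<noteq> f" by (auto simp: card_2_iff)
      then have ef: "e \<in> E" "f \<in> E" by (auto simp: I_def)
      obtain a where a: "en e = {v, a}" "a \<noteq> v" "a \<in> V" using other[of e] I by auto
      obtain b where b: "en f = {v, b}" "b \<noteq> v" "b \<in> V" using other[of f] I by auto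
      have at_v: "g = e \<or> g = f" if "g \<in> E" "v \<in> en g" for g using that I by (auto simp: I_def)
      have "a \<noteq> b" using simple(3) ef I(2) a b by (auto simp: inj_on_def)
      let ?en = "en(e := {a, b})"
      have "\<nexists>B. K4_model (V - {v}) (link ?en (E - {f})) B"
      proof
        assume "\<exists>B. K4_model (V - {v}) (link ?en (E - {f})) B"
        \<comment> \<open>Suppressing \<open>v\<close> amounts to contracting \<open>v\<close> into
          \<open>a\<close>, so a \<open>K4\<close> model found afterwards lifts back. Here
          \<open>a \<noteq> b\<close> keeps the redirected edge from being a loop.\<close>
        moreover have "link ?en (E - {f}) \<subseteq> contraction v a ?R"
        proof clarify
          fix y z assume "(y, z) \<in> link ?en (E - {f})"
          then obtain g where g: "g \<in> E - {f}" "?en g = {y, z}" by (rule linkE)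
          show "(y, z) \<in> contraction v a ?R"
          proof (cases "g = e")
            case True
            have vb: "(v, b) \<in> ?R" "(b, v) \<in> ?R" using ef b by (auto intro: linkI[of f])
            have "merge v a v = a" "merge v a b = b" using b by (auto simp: merge_def)
            then have "(a, b) \<in> contraction v a ?R" "(b, a) \<in> contraction v a ?R"
              using contractionI[OF vb(1), of v a] contractionI[OF vb(2), of v a] \<open>a \<noteq> b\<close> by auto
            then show ?thesis using True g by (auto simp: doubleton_eq_iff)
          next
            case False
            then have en_g: "en g = {y, z}" "g \<in> E" "g \<noteq> f" using g by simp_all
            then have "v \<notin> {y, z}" using at_v[of g] False by auto
            moreover have "y \<noteq> z" using simple(2)[OF en_g(2)] en_g(1) by auto
            moreover have "(y, z) \<in> ?R" using en_g by (intro linkI[of g]) auto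
            ultimately show ?thesis by (intro contraction_memI) auto
          qed
        qed
        ultimately have "\<exists>B. K4_model (V - {v}) (contraction v a ?R) B"
          using K4_model_mono by blast
        moreover have "(v, a) \<in> ?R" using a ef by (auto intro: linkI[of e])
        ultimately show False
          using K4_model_contraction[OF _ sym_link _ v(1) a(2)[symmetric]] no_K4 by blast
      qed
      moreover have "?en g \<subseteq> V - {v} \<and> card (?en g) \<in> {1, 2}" if "g \<in> E - {f}" for g
        using that en[of g] at_v[of g] a b \<open>a \<noteq> b\<close> by auto
      moreover have "connects (V - {v}) ?en (E - {f})"
        using connects_contract_series[OF conn ef(1) a(1) b(1) I(2) a(3) a(2)[symmetric] b(2)[symmetric]] at_v
        by blast
      ultimately have "polynomially_dense (E - {f}) (trees (V - {v}) ?en (E - {f}))"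
        using less.prems smaller[OF ef(2)] a by (intro less.hyps) auto
      then have dense: "polynomially_dense (insert f (E - {f})) (series_extension e f (trees (V - {v}) ?en (E - {f})))"
        using smaller[OF ef(2)] ef I(2) by (intro polynomially_dense_series) (auto dest: trees_subset)
      have sub: "trees V en E \<subseteq> series_extension e f (trees (V - {v}) ?en (E - {f}))"
      proof (rule trees_series[of e E en v a f b V])
        show "g = e \<or> g = f" if "g \<in> E" "v \<in> en g" for g by (rule at_v[OF that])
      qed (use a b ef I(2) v(1) in simp_all)
      show ?thesis
        using polynomially_dense_mono[OF dense sub] less.prems(3) ef(2) by (simp add: insert_absorb)
    qed
  qed
qed

lemma shortest_path:
  assumes "(u, v) \<in> R\<^sup>*"
  obtains n p where "p 0 = u" "p n = v" "\<And>i. i < n \<Longrightarrow> (p i, p (Suc i)) \<in> R" "inj_on p {..n}"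
proof -
  define n where "n = (LEAST n. (u, v) \<in> R ^^ n)"
  obtain m where "(u, v) \<in> R ^^ m" using assms rtrancl_imp_relpow by blast
  then have n: "(u, v) \<in> R ^^ n" unfolding n_def by (rule LeastI)
  then obtain p where p: "p 0 = u" "p n = v" "\<And>i. i < n \<Longrightarrow> (p i, p (Suc i)) \<in> R"
    by (auto simp: relpow_fun_conv)
  \<comment> \<open>Subpaths: cutting out the piece between two visits of one vertex would give a
    path of length \<open>i + (n - j) < n\<close>.\<close>
  have step: "(p i, p (i + k)) \<in> R ^^ k" if "i + k \<le> n" for i k
    unfolding relpow_fun_conv using that p(3) by (intro exI[of _ "\<lambda>j. p (i + j)"]) auto
  have "p i \<noteq> p j" if "i < j" "j \<le> n" for i j
  proof
    assume "p i = p j"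
    then have "(u, p j) \<in> R ^^ i" using step[of 0 i] that p by simp
    moreover have "(p j, v) \<in> R ^^ (n - j)" using step[of j "n - j"] that p by simp
    ultimately have "(u, v) \<in> R ^^ (i + (n - j))" by (auto simp: relpow_add)
    then have "n \<le> i + (n - j)" unfolding n_def by (rule Least_le)
    then show False using that by simp
  qed
  then have "inj_on p {..n}" unfolding inj_on_def by (metis atMost_iff linorder_neqE_nat)
  then show ?thesis using that p by blast
qed

text \<open>The ends of \<open>e\<close> are still joined without \<open>e\<close>, and a shortest
  path between them is closed to a cycle by \<open>e\<close>. A loop gives a path of length 0,
  matching the convention that a loop is a cycle of length 1.\<close>

lemma cycle_if_not_minimal:
  assumes "wf_multigraph G" "T \<subseteq> edges G" "e \<in> T" "connects (vertices G) (ends G) (T - {e})"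
  shows "\<exists>vs es. is_cycle (G\<lparr>edges := T\<rparr>) vs es"
proof -
  have wf: "ends G g \<subseteq> vertices G \<and> card (ends G g) \<in> {1, 2}" if "g \<in> T" for g
    using assms(1,2) that by (auto simp: wf_multigraph_def)
  obtain u v where uv: "ends G e = {u, v}"
    using wf[OF assms(3)] by (auto simp: card_1_singleton_iff card_2_iff)
  then have "(v, u) \<in> (link (ends G) (T - {e}))\<^sup>*"
    using assms(4) wf[OF assms(3)] by (auto simp: connects_def)
  then obtain n p where p: "p 0 = v" "p n = u"
    "\<And>i. i < n \<Longrightarrow> (p i, p (Suc i)) \<in> link (ends G) (T - {e})" "inj_on p {..n}"
    by (rule shortest_path) blast
  have "\<forall>i\<in>{..<n}. \<exists>g. g \<in> T - {e} \<and> ends G g = {p i, p (Suc i)}"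
    using p(3) by (metis lessThan_iff linkE)
  then obtain g where g: "\<And>i. i < n \<Longrightarrow> g i \<in> T - {e} \<and> ends G (g i) = {p i, p (Suc i)}"
    by (auto dest!: bchoice)
  have "inj_on g {..<n}"
  proof (rule inj_onI)
    fix i j assume ij: "i \<in> {..<n}" "j \<in> {..<n}" "g i = g j"
    then have "{p i, p (Suc i)} = {p j, p (Suc j)}" using g[of i] g[of j] by simp
    then have "p ` {i, Suc i} = p ` {j, Suc j}" by simp
    then have "{i, Suc i} = {j, Suc j}"
      by (rule inj_on_image_eq_iff[OF p(4), THEN iffD1, rotated 2]) (use ij in auto)
    then show "i = j" by (auto simp: doubleton_eq_iff)
  qed
  define vs where "vs = map p [0..<Suc n]"
  \<comment> \<open>The edge \<open>e\<close> comes last: it runs from \<open>p n = u\<close> back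
    to \<open>p 0 = v\<close>, where the index wraps around modulo \<open>Suc n\<close>.\<close>
  define es where "es = map g [0..<n] @ [e]"
  have "p i \<in> vertices G" if "i \<le> n" for i
  proof (cases "i < n")
    case True
    then show ?thesis using g[OF True] wf by auto
  next
    case False
    then show ?thesis using p(2) that uv wf[OF assms(3)] by auto
  qed
  then have "set vs \<subseteq> vertices G" by (auto simp: vs_def simp del: upt_Suc)
  moreover have "distinct vs"
    using p(4) by (simp add: vs_def distinct_map atLeast0LessThan lessThan_Suc_atMost del: upt_Suc)
  moreover have "distinct es"
    using \<open>inj_on g {..<n}\<close> g by (auto simp: es_def distinct_map atLeast0LessThan)
  moreover have "set es \<subseteq> T" using g assms(3) by (auto simp: es_def)
  moreover have "ends G (es ! i) = {vs ! i, vs ! (Suc i mod length es)}" if "i < length es" for i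
  proof (cases "i < n")
    case True
    then show ?thesis using g[OF True] by (simp add: es_def vs_def nth_append del: upt_Suc)
  next
    case False
    then have "i = n" using that by (simp add: es_def)
    then show ?thesis using uv p by (auto simp: es_def vs_def nth_append simp del: upt_Suc)
  qed
  ultimately have "is_cycle (G\<lparr>edges := T\<rparr>) vs es"
    by (auto simp: is_cycle_def vs_def es_def simp del: upt_Suc)
  then show ?thesis by blast
qed

lemma adjacency_eq_link: "adjacency (G\<lparr>edges := T\<rparr>) = link (ends G) T"
  by (simp add: adjacency_def link_def)

lemma spanning_tree_edges_in_trees:
  assumes "wf_multigraph G" "spanning_tree_edges G T"
  shows "T \<in> trees (vertices G) (ends G) (edges G)"
proof -
  have T: "T \<subseteq> edges G" "connects (vertices G) (ends G) T"
    "\<nexists>vs es. is_cycle (G\<lparr>edges := T\<rparr>) vs es"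
    using assms(2)
    by (auto simp: spanning_tree_edges_def is_tree_def connected_multigraph_def adjacency_eq_link
        connects_def)
  then show ?thesis
    using cycle_if_not_minimal[OF assms(1) T(1)] by (auto simp: trees_def minimally_connects_def)
qed

text \<open>Choose for each edge of \<open>K4\<close> some edge joining its two branch sets. By
  disjointness it meets exactly these two, so the choice is injective and no chosen edge lies inside
  a branch set; removing the chosen edges leaves the branch sets connected.\<close>

lemma is_minor_K4_if_K4_model:
  assumes "wf_multigraph G" "K4_model (vertices G) (link (ends G) (edges G)) B"
  shows "is_minor K4 G"
proof -
  let ?L = "link (ends G) (edges G)"
  have B: "\<And>i. i < 4 \<Longrightarrow> B i \<subseteq> vertices G" "\<And>i. i < 4 \<Longrightarrow> connected_in ?L (B i)"
    "\<And>i j. i < 4 \<Longrightarrow> j < 4 \<Longrightarrow> i \<noteq> j \<Longrightarrow> B i \<inter> B j = {}"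
    "\<And>i j. i < 4 \<Longrightarrow> j < 4 \<Longrightarrow> i \<noteq> j \<Longrightarrow> \<exists>a\<in>B i. \<exists>b\<in>B j. (a, b) \<in> ?L"
    using assms(2) by (auto simp: K4_model_def)
  define joins where "joins = (\<lambda>f i j. \<exists>a\<in>B i. \<exists>b\<in>B j. ends G f = {a, b})"
  have joins_sym: "joins f i j \<longleftrightarrow> joins f j i" for f i j
    by (auto simp: joins_def insert_commute)
  have "\<forall>f\<in>edges K4. \<exists>e. e \<in> edges G \<and> (\<forall>x y. f = {x, y} \<longrightarrow> joins e x y)"
  proof
    fix f assume "f \<in> edges K4"
    then obtain x y where f: "f = {x, y}" "x \<noteq> y" "x < 4" "y < 4"
      by (auto simp: K4_def card_2_iff)
    then obtain e where "e \<in> edges G" "joins e x y"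
      using B(4)[of x y] by (auto simp: joins_def elim!: linkE)
    then show "\<exists>e. e \<in> edges G \<and> (\<forall>x y. f = {x, y} \<longrightarrow> joins e x y)"
      using f joins_sym by (auto simp: doubleton_eq_iff)
  qed
  then obtain \<phi> where \<phi>: "\<And>f. f \<in> edges K4 \<Longrightarrow> \<phi> f \<in> edges G"
    "\<And>f x y. f \<in> edges K4 \<Longrightarrow> f = {x, y} \<Longrightarrow> joins (\<phi> f) x y"
    by (auto dest!: bchoice)
  have edge: "\<exists>x y. f = {x, y} \<and> x \<noteq> y \<and> x < 4 \<and> y < 4" if "f \<in> edges K4" for f
    using that by (auto simp: K4_def card_2_iff)
  have meets: "ends G (\<phi> f) \<inter> B z \<noteq> {} \<longleftrightarrow> z \<in> f" if f: "f \<in> edges K4" and z: "z < 4" for f z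
  proof -
    obtain x y where xy: "f = {x, y}" "x \<noteq> y" "x < 4" "y < 4" using edge[OF f] by blast
    obtain a b where ab: "a \<in> B x" "b \<in> B y" "ends G (\<phi> f) = {a, b}"
      using \<phi>(2)[OF f xy(1)] by (auto simp: joins_def)
    have "a \<in> B z \<longleftrightarrow> z = x" "b \<in> B z \<longleftrightarrow> z = y"
      using B(3)[of x z] B(3)[of y z] ab xy z by auto
    then show ?thesis using ab(3) xy(1) by auto
  qed
  have "inj_on \<phi> (edges K4)"
  proof (rule inj_onI)
    fix f g assume fg: "f \<in> edges K4" "g \<in> edges K4" "\<phi> f = \<phi> g"
    then have "z \<in> f \<longleftrightarrow> z \<in> g" if "z < 4" for z
      using meets[OF fg(1) that] meets[OF fg(2) that] by simp
    then show "f = g" using fg(1,2) by (auto simp: K4_def)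
  qed
  moreover have "connected_multigraph
      (G\<lparr>vertices := B i, edges := {e \<in> edges G - \<phi> ` edges K4. ends G e \<subseteq> B i}\<rparr>)" if i: "i < 4" for i
  proof -
    have "?L \<inter> B i \<times> B i
        \<subseteq> adjacency (G\<lparr>vertices := B i, edges := {e \<in> edges G - \<phi> ` edges K4. ends G e \<subseteq> B i}\<rparr>)"
    proof clarify
      fix a b assume ab: "(a, b) \<in> ?L" "a \<in> B i" "b \<in> B i"
      then obtain e where e: "e \<in> edges G" "ends G e = {a, b}" by (auto elim: linkE)
      have "e \<noteq> \<phi> f" if f: "f \<in> edges K4" for f
      proof
        assume "e = \<phi> f"
        have sub: "ends G (\<phi> f) \<subseteq> B i" using \<open>e = \<phi> f\<close> e ab by simp
        obtain x y where xy: "f = {x, y}" "x \<noteq> y" "x < 4" "y < 4" using edge[OF f] by blast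
        then have "ends G (\<phi> f) \<inter> B x \<noteq> {}" "ends G (\<phi> f) \<inter> B y \<noteq> {}" using meets[OF f] by auto
        then have "B i \<inter> B x \<noteq> {}" "B i \<inter> B y \<noteq> {}" using sub by auto
        then show False using B(3)[OF i] xy by metis
      qed
      then have "e \<in> {e \<in> edges G - \<phi> ` edges K4. ends G e \<subseteq> B i}" using e ab by auto
      then show "(a, b) \<in> adjacency
          (G\<lparr>vertices := B i, edges := {e \<in> edges G - \<phi> ` edges K4. ends G e \<subseteq> B i}\<rparr>)"
        using e(2) unfolding adjacency_def by (simp, blast)
    qed
    then show ?thesis
      using B(2)[OF i] rtrancl_mono unfolding connected_in_def connected_multigraph_def
      by (simp del: Int_iff) blast
  qed
  ultimately show ?thesis
    unfolding is_minor_def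
    using B(1,3) \<phi> by (intro exI[of _ B] exI[of _ \<phi>]) (auto simp: K4_def joins_def)
qed

section \<open>Oriented embeddings as configurations\<close>

definition ones :: "bool list \<Rightarrow> nat set" where
  "ones x = {i. i < length x \<and> x ! i}"

definition bits :: "nat \<Rightarrow> nat set \<Rightarrow> bool list" where
  "bits n A = map (\<lambda>i. i \<in> A) [0..<n]"

text \<open>The list \<open>es\<close> translates positions of a bit string into edges. The
  restriction to the cube matches the extensionality that \<open>cube_embedding\<close>
  demands.\<close>

definition config_embedding ::
  "'e list \<Rightarrow> nat \<Rightarrow> ('e \<Rightarrow> nat) \<times> nat set \<Rightarrow> bool list \<Rightarrow> bool list" where
  "config_embedding es n = (\<lambda>(\<sigma>, Z). \<lambda>x\<in>cube (length es). bits n (Z \<union> \<sigma> ` (!) es ` ones x))"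

lemma length_bits [simp]: "length (bits n A) = n"
  by (simp add: bits_def)

lemma nth_bits [simp]: "i < n \<Longrightarrow> bits n A ! i \<longleftrightarrow> i \<in> A"
  by (simp add: bits_def)

lemma bits_ones: "x \<in> cube n \<Longrightarrow> bits n (ones x) = x"
  by (auto simp: cube_def ones_def intro!: nth_equalityI)

lemma cube_eqI: "x \<in> cube n \<Longrightarrow> y \<in> cube n \<Longrightarrow> (\<And>i. i < n \<Longrightarrow> x ! i = y ! i) \<Longrightarrow> x = y"
  by (auto simp: cube_def intro: nth_equalityI)

lemma cube_le_iff: "x \<in> cube n \<Longrightarrow> y \<in> cube n \<Longrightarrow> cube_le x y \<longleftrightarrow> (\<forall>i<n. x ! i \<longrightarrow> y ! i)"
  by (auto simp: cube_le_def cube_def list_all2_conv_all_nth)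

lemma config_embedding_nth:
  assumes "x \<in> cube (length es)" "i < n"
  shows "config_embedding es n (\<sigma>, Z) x ! i \<longleftrightarrow> i \<in> Z \<or> (\<exists>j<length es. x ! j \<and> i = \<sigma> (es ! j))"
  using assms by (auto simp: config_embedding_def ones_def cube_def)

lemma config_embedding_in_cube:
  "x \<in> cube (length es) \<Longrightarrow> config_embedding es n c x \<in> cube n"
  by (cases c) (simp add: config_embedding_def cube_def)

lemma configurations_nth:
  assumes "(\<sigma>, Z) \<in> configurations (set es) n" "distinct es"
  shows "inj_on (\<lambda>j. \<sigma> (es ! j)) {..<length es}"
    and "j < length es \<Longrightarrow> \<sigma> (es ! j) < n" "j < length es \<Longrightarrow> \<sigma> (es ! j) \<notin> Z" "Z \<subseteq> {..<n}"
proof -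
  have "inj_on \<sigma> (set es)" using assms(1) by (simp add: configurations_def)
  then show "inj_on (\<lambda>j. \<sigma> (es ! j)) {..<length es}"
    using assms(2) unfolding inj_on_def by (metis lessThan_iff nth_eq_iff_index_eq nth_mem)
  show "\<sigma> (es ! j) < n" if "j < length es"
    using PiE_mem[of \<sigma> "set es" "\<lambda>_. {..<n}" "es ! j"] assms(1) that
    by (auto simp: configurations_def)
  show "\<sigma> (es ! j) \<notin> Z" if "j < length es"
    using assms(1) that by (auto simp: configurations_def)
  show "Z \<subseteq> {..<n}" using assms(1) by (auto simp: configurations_def)
qed

lemma config_embedding_nth_image:
  assumes "(\<sigma>, Z) \<in> configurations (set es) n" "distinct es" "x \<in> cube (length es)" "j < length es"
  shows "config_embedding es n (\<sigma>, Z) x ! \<sigma> (es ! j) = x ! j"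
  using configurations_nth[OF assms(1,2)] assms(3,4) config_embedding_nth[OF assms(3)]
  by (auto simp: inj_on_def)

lemma config_embedding_oriented:
  assumes c: "(\<sigma>, Z) \<in> configurations (set es) n" and "distinct es"
  shows "config_embedding es n (\<sigma>, Z) \<in> oriented_embeddings (length es) n"
proof -
  let ?d = "length es" and ?\<psi> = "config_embedding es n (\<sigma>, Z)"
  define \<tau> where "\<tau> = (\<lambda>j. \<sigma> (es ! j))"
  have \<tau>: "inj_on \<tau> {..<?d}" "\<And>j. j < ?d \<Longrightarrow> \<tau> j < n" "\<And>j. j < ?d \<Longrightarrow> \<tau> j \<notin> Z"
    using configurations_nth[OF assms] by (simp_all add: \<tau>_def)
  note in_cube = config_embedding_in_cube[of _ es n "(\<sigma>, Z)"]
  have at_\<tau>: "?\<psi> x ! \<tau> j = x ! j" if "x \<in> cube ?d" "j < ?d" for x j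
    using config_embedding_nth_image[OF assms that] by (simp add: \<tau>_def)
  have off_\<tau>: "?\<psi> x ! i \<longleftrightarrow> i \<in> Z" if "x \<in> cube ?d" "i < n" "i \<notin> \<tau> ` {..<?d}" for x i
    using config_embedding_nth[OF that(1,2)] that(3) by (auto simp: \<tau>_def)
  define F where "F = {y \<in> cube n. \<forall>i\<in>{..<n} - \<tau> ` {..<?d}. y ! i = bits n Z ! i}"
  have "is_face n ?d F"
    unfolding is_face_def F_def
    using \<tau> by (intro exI[of _ "\<tau> ` {..<?d}"] exI[of _ "bits n Z"]) (auto simp: card_image cube_def)
  moreover have "bij_betw ?\<psi> (cube ?d) F"
  proof (intro bij_betw_imageI inj_onI)
    fix x y assume "x \<in> cube ?d" "y \<in> cube ?d" "?\<psi> x = ?\<psi> y"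
    then show "x = y" using at_\<tau> by (metis cube_eqI)
  next
    show "?\<psi> ` cube ?d = F"
    proof (intro equalityI subsetI)
      fix y assume "y \<in> ?\<psi> ` cube ?d"
      then show "y \<in> F" using in_cube off_\<tau> by (auto simp: F_def)
    next
      fix y assume y: "y \<in> F"
      define x where "x = map (\<lambda>j. y ! \<tau> j) [0..<?d]"
      have x: "x \<in> cube ?d" by (simp add: x_def cube_def)
      have "?\<psi> x ! i = y ! i" if i: "i < n" for i
      proof (cases "i \<in> \<tau> ` {..<?d}")
        case True
        then show ?thesis using at_\<tau>[OF x] by (auto simp: x_def)
      next
        case False
        then show ?thesis using off_\<tau>[OF x i False] y i by (auto simp: F_def)
      qed
      then have "?\<psi> x = y" using in_cube[OF x] y by (intro cube_eqI[of _ n]) (auto simp: F_def)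
      then show "y \<in> ?\<psi> ` cube ?d" using x by blast
    qed
  qed
  moreover have "cube_adj ?d x y \<longleftrightarrow> cube_adj n (?\<psi> x) (?\<psi> y)" if xy: "x \<in> cube ?d" "y \<in> cube ?d" for x y
  proof -
    have "{i. i < n \<and> ?\<psi> x ! i \<noteq> ?\<psi> y ! i} = \<tau> ` {j. j < ?d \<and> x ! j \<noteq> y ! j}"
    proof (intro equalityI subsetI)
      fix i assume i: "i \<in> {i. i < n \<and> ?\<psi> x ! i \<noteq> ?\<psi> y ! i}"
      then have "i \<in> \<tau> ` {..<?d}" using off_\<tau> xy by blast
      then show "i \<in> \<tau> ` {j. j < ?d \<and> x ! j \<noteq> y ! j}" using i at_\<tau> xy by auto
    qed (use at_\<tau> xy \<tau> in auto)
    moreover have "card (\<tau> ` {j. j < ?d \<and> x ! j \<noteq> y ! j}) = card {j. j < ?d \<and> x ! j \<noteq> y ! j}"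
      using \<tau>(1) by (intro card_image) (auto simp: inj_on_def)
    ultimately show ?thesis using xy in_cube by (simp add: cube_adj_def)
  qed
  moreover have "cube_le (?\<psi> x) (?\<psi> y)" if xy: "x \<in> cube ?d" "y \<in> cube ?d" "cube_le x y" for x y
    using xy config_embedding_nth[OF xy(1)] config_embedding_nth[OF xy(2)]
    by (auto simp: cube_le_iff[OF in_cube[OF xy(1)] in_cube[OF xy(2)]] cube_le_iff[OF xy(1,2)])
  moreover have "?\<psi> \<in> extensional (cube ?d)" by (simp add: config_embedding_def)
  ultimately show ?thesis by (auto simp: oriented_embeddings_def cube_embedding_def)
qed

text \<open>The all-zero string reveals \<open>Z\<close>; a string with a single one at
  \<open>k\<close> then reveals the image of the edge \<open>es ! k\<close>.\<close>

lemma config_embedding_inj: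
  assumes "distinct es"
  shows "inj_on (config_embedding es n) (configurations (set es) n)"
proof (rule inj_onI)
  fix c c' assume c: "c \<in> configurations (set es) n" "c' \<in> configurations (set es) n"
    "config_embedding es n c = config_embedding es n c'"
  obtain \<sigma> Z where s: "c = (\<sigma>, Z)" by (cases c)
  obtain \<tau> Y where t: "c' = (\<tau>, Y)" by (cases c')
  let ?d = "length es"
  note \<sigma> = configurations_nth[OF c(1)[unfolded s] assms]
  note \<tau> = configurations_nth[OF c(2)[unfolded t] assms]
  have eq: "i \<in> Z \<or> (\<exists>j<?d. x ! j \<and> i = \<sigma> (es ! j)) \<longleftrightarrow> i \<in> Y \<or> (\<exists>j<?d. x ! j \<and> i = \<tau> (es ! j))"
    if "x \<in> cube ?d" "i < n" for x i
    using config_embedding_nth[OF that] c(3) s t by metis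
  have "replicate ?d False \<in> cube ?d" by (simp add: cube_def)
  from eq[OF this] have "i \<in> Z \<longleftrightarrow> i \<in> Y" if "i < n" for i using that by (metis nth_replicate)
  then have ZY: "Z = Y" using \<sigma>(4) \<tau>(4) by blast
  have "\<sigma> (es ! k) = \<tau> (es ! k)" if k: "k < ?d" for k
  proof -
    let ?x = "(replicate ?d False)[k := True]"
    have "?x \<in> cube ?d" by (simp add: cube_def)
    moreover have "j < ?d \<Longrightarrow> ?x ! j \<longleftrightarrow> j = k" for j using k by (simp add: nth_list_update)
    ultimately show ?thesis
      using eq[of ?x "\<sigma> (es ! k)"] \<sigma>(2,3)[OF k] ZY k by auto
  qed
  then have "\<forall>e\<in>set es. \<sigma> e = \<tau> e" by (metis in_set_conv_nth)
  then have "\<sigma> = \<tau>"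
    using c(1,2) s t by (auto simp: configurations_def intro: PiE_ext)
  then show "c = c'" using ZY s t by simp
qed

text \<open>The images of the zero string and of the unit strings determine everything: the former
  gives \<open>Z\<close>, the coordinate switched on by the \<open>j\<close>-th unit gives
  \<open>\<sigma> (es ! j)\<close>.\<close>

lemma oriented_embedding_is_config_embedding:
  assumes \<psi>: "\<psi> \<in> oriented_embeddings (length es) n" and "distinct es"
  shows "\<psi> \<in> config_embedding es n ` configurations (set es) n"
proof -
  let ?d = "length es"
  obtain J a F where F: "J \<subseteq> {..<n}" "a \<in> cube n" "F = {x \<in> cube n. \<forall>i\<in>{..<n} - J. x ! i = a ! i}"
    and bij: "bij_betw \<psi> (cube ?d) F"
    using \<psi> by (auto simp: oriented_embeddings_def cube_embedding_def is_face_def)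
  have ext: "\<psi> \<in> extensional (cube ?d)"
    and adj: "\<And>x y. x \<in> cube ?d \<Longrightarrow> y \<in> cube ?d \<Longrightarrow> cube_adj ?d x y \<Longrightarrow> cube_adj n (\<psi> x) (\<psi> y)"
    and mono: "\<And>x y. x \<in> cube ?d \<Longrightarrow> y \<in> cube ?d \<Longrightarrow> cube_le x y \<Longrightarrow> cube_le (\<psi> x) (\<psi> y)"
    using \<psi> by (auto simp: oriented_embeddings_def cube_embedding_def)
  have in_F: "\<psi> x \<in> F" and in_cube: "\<psi> x \<in> cube n" if "x \<in> cube ?d" for x
    using that bij F by (auto simp: bij_betw_def)
  have inj: "inj_on \<psi> (cube ?d)" using bij by (simp add: bij_betw_def)
  \<comment> \<open>Adjacency says that exactly one coordinate changes, orientation that it changes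
    from 0 to 1.\<close>
  have flip: "\<exists>i<n. \<not> \<psi> x ! i \<and> \<psi> y ! i \<and> (\<forall>k<n. k \<noteq> i \<longrightarrow> \<psi> x ! k = \<psi> y ! k)"
    if xy: "x \<in> cube ?d" "j < ?d" "\<not> x ! j" "y = x[j := True]" for x y j
  proof -
    have y: "y \<in> cube ?d" using xy by (simp add: cube_def)
    have "{i. i < ?d \<and> x ! i \<noteq> y ! i} = {j}" using xy by (auto simp: nth_list_update cube_def)
    then have "cube_adj n (\<psi> x) (\<psi> y)" using adj[OF xy(1) y] xy(1) y by (simp add: cube_adj_def)
    then obtain i where i: "{i. i < n \<and> \<psi> x ! i \<noteq> \<psi> y ! i} = {i}"
      by (auto simp: cube_adj_def card_1_singleton_iff)
    have "cube_le x y" using xy y by (auto simp: cube_le_iff[of _ ?d] nth_list_update cube_def)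
    then have "\<forall>k<n. \<psi> x ! k \<longrightarrow> \<psi> y ! k"
      using mono[OF xy(1) y] cube_le_iff[OF in_cube[OF xy(1)] in_cube[OF y]] by simp
    moreover have "i < n" "\<psi> x ! i \<noteq> \<psi> y ! i" "\<forall>k<n. k \<noteq> i \<longrightarrow> \<psi> x ! k = \<psi> y ! k" using i by blast+
    ultimately show ?thesis by blast
  qed
  define o0 where "o0 = replicate ?d False"
  have o0: "o0 \<in> cube ?d" "\<And>j. j < ?d \<Longrightarrow> \<not> o0 ! j" by (auto simp: o0_def cube_def)
  have "\<forall>j. \<exists>i. j < ?d \<longrightarrow> i < n \<and> \<not> \<psi> o0 ! i \<and> \<psi> (o0[j := True]) ! i
      \<and> (\<forall>k<n. k \<noteq> i \<longrightarrow> \<psi> o0 ! k = \<psi> (o0[j := True]) ! k)"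
    using flip[OF o0(1)] o0(2) by blast
  from choice[OF this] obtain t where "\<forall>j. j < ?d \<longrightarrow> t j < n \<and> \<not> \<psi> o0 ! t j \<and> \<psi> (o0[j := True]) ! t j
      \<and> (\<forall>k<n. k \<noteq> t j \<longrightarrow> \<psi> o0 ! k = \<psi> (o0[j := True]) ! k)" by blast
  then have t: "\<And>j. j < ?d \<Longrightarrow> t j < n" "\<And>j. j < ?d \<Longrightarrow> \<not> \<psi> o0 ! t j"
    "\<And>j. j < ?d \<Longrightarrow> \<psi> (o0[j := True]) ! t j"
    "\<And>j k. j < ?d \<Longrightarrow> k < n \<Longrightarrow> k \<noteq> t j \<Longrightarrow> \<psi> o0 ! k = \<psi> (o0[j := True]) ! k"
    by blast+
  have unit: "o0[j := True] \<in> cube ?d" for j using o0 by (simp add: cube_def)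
  have inj_t: "inj_on t {..<?d}"
  proof (rule inj_onI)
    fix j k assume jk: "j \<in> {..<?d}" "k \<in> {..<?d}" "t j = t k"
    have "\<psi> (o0[j := True]) = \<psi> (o0[k := True])"
    proof (rule cube_eqI[OF in_cube[OF unit] in_cube[OF unit]])
      fix i assume "i < n"
      then show "\<psi> (o0[j := True]) ! i = \<psi> (o0[k := True]) ! i"
        using t(3)[of j] t(3)[of k] t(4)[of j i] t(4)[of k i] jk by (cases "i = t j") simp_all
    qed
    then have "o0[j := True] = o0[k := True]" using inj_onD[OF inj _ unit unit] by blast
    moreover have "o0[j := True] ! j" using jk o0(1) by (simp add: cube_def)
    ultimately have "o0[k := True] ! j" by simp
    then show "j = k" using o0(2)[of j] jk by (metis lessThan_iff nth_list_update_neq)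
  qed
  \<comment> \<open>Induction on the number of ones. Switching on \<open>j\<close> changes a single
    coordinate, which must be \<open>t j\<close>: it is off at \<open>x'\<close> since
    \<open>t\<close> is injective, and on at \<open>x\<close> since \<open>x\<close> lies above the
    \<open>j\<close>-th unit string.\<close>
  have nth: "\<psi> x ! i \<longleftrightarrow> \<psi> o0 ! i \<or> (\<exists>j<?d. x ! j \<and> i = t j)" if "x \<in> cube ?d" "i < n" for x i
    using that
  proof (induction "card (ones x)" arbitrary: x i)
    case 0
    have "finite (ones x)" by (simp add: ones_def)
    then have "ones x = {}" using 0 by simp
    then have none: "\<not> x ! j" if "j < ?d" for j using that 0 by (auto simp: ones_def cube_def)
    then have "x = o0" using 0 o0 by (intro cube_eqI[of _ ?d]) auto
    then show ?case using none by auto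
  next
    case (Suc m)
    then have "ones x \<noteq> {}" by auto
    then obtain j where j: "j < ?d" "x ! j" using Suc.prems by (auto simp: ones_def cube_def)
    define x' where "x' = x[j := False]"
    have x': "x' \<in> cube ?d" using Suc.prems by (simp add: x'_def cube_def)
    have x'_nth: "x' ! k \<longleftrightarrow> x ! k \<and> k \<noteq> j" if "k < ?d" for k
      using that j Suc.prems by (simp add: x'_def nth_list_update cube_def)
    have "ones x' = ones x - {j}"
      using x'_nth x' Suc.prems by (auto simp: ones_def cube_def)
    then have "m = card (ones x')" using Suc(2) j Suc.prems by (simp add: ones_def cube_def)
    note IH = Suc(1)[OF this x']
    have "x = x'[j := True]" using j Suc.prems by (simp add: x'_def) (metis list_update_id)
    then obtain i' where i': "i' < n" "\<not> \<psi> x' ! i'" "\<psi> x ! i'" "\<forall>k<n. k \<noteq> i' \<longrightarrow> \<psi> x' ! k = \<psi> x ! k"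
      using flip[OF x' j(1)] x'_nth j by blast
    have "\<not> \<psi> x' ! t j"
      using IH[of "t j"] t(1,2)[OF j(1)] x'_nth inj_t j by (auto simp: inj_on_def)
    moreover have "\<psi> x ! t j"
    proof -
      have "cube_le (o0[j := True]) x"
        using o0 j Suc.prems unit
        by (auto simp: cube_le_iff[OF unit Suc.prems(1)] nth_list_update cube_def)
      then show ?thesis
        using mono[OF unit Suc.prems(1)] cube_le_iff[OF in_cube[OF unit] in_cube[OF Suc.prems(1)]]
          t(1,3)[OF j(1)] by blast
    qed
    ultimately have "i' = t j" using i'(4) t(1)[OF j(1)] by metis
    then have "\<psi> x ! i \<longleftrightarrow> \<psi> x' ! i \<or> i = t j" using i' Suc.prems(2) by metis
    then show ?case using IH[OF Suc.prems(2)] x'_nth j by auto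
  qed
  define Z where "Z = {i. i < n \<and> \<psi> o0 ! i}"
  define \<sigma> where "\<sigma> = (\<lambda>e\<in>set es. t (the_inv_into {..<?d} ((!) es) e))"
  have inj_nth: "inj_on ((!) es) {..<?d}" using assms(2) by (auto simp: inj_on_def nth_eq_iff_index_eq)
  have \<sigma>: "\<sigma> (es ! j) = t j" if "j < ?d" for j
    using that the_inv_into_f_f[OF inj_nth, of j] by (simp add: \<sigma>_def)
  have set_es: "set es = (!) es ` {..<?d}" by (auto simp: set_conv_nth)
  have "inj_on \<sigma> (set es)"
    using inj_t \<sigma> unfolding set_es by (auto simp: inj_on_def)
  moreover have "\<sigma> \<in> set es \<rightarrow>\<^sub>E {..<n}"
  proof
    fix e assume "e \<in> set es"
    then show "\<sigma> e \<in> {..<n}" using \<sigma> t(1) by (auto simp: set_conv_nth)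
  qed (auto simp: \<sigma>_def)
  moreover have "Z \<subseteq> {..<n} - \<sigma> ` set es"
    using \<sigma> t(2) by (auto simp: Z_def set_conv_nth)
  ultimately have c: "(\<sigma>, Z) \<in> configurations (set es) n" by (simp add: configurations_def)
  have "\<psi> = config_embedding es n (\<sigma>, Z)"
  proof (rule extensionalityI[OF ext])
    show "config_embedding es n (\<sigma>, Z) \<in> extensional (cube ?d)" by (simp add: config_embedding_def)
    fix x assume x: "x \<in> cube ?d"
    show "\<psi> x = config_embedding es n (\<sigma>, Z) x"
    proof (rule cube_eqI[OF in_cube[OF x] config_embedding_in_cube[OF x]])
      fix i assume i: "i < n"
      have "(\<exists>j<?d. x ! j \<and> i = \<sigma> (es ! j)) \<longleftrightarrow> (\<exists>j<?d. x ! j \<and> i = t j)" using \<sigma> by auto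
      then show "\<psi> x ! i = config_embedding es n (\<sigma>, Z) x ! i"
        using nth[OF x i] config_embedding_nth[OF x i] i by (simp add: Z_def)
    qed
  qed
  then show ?thesis using c by blast
qed

lemma oriented_embeddings_eq:
  "distinct es \<Longrightarrow>
    oriented_embeddings (length es) n = config_embedding es n ` configurations (set es) n"
  using oriented_embedding_is_config_embedding config_embedding_oriented by fast

lemma config_embedding_indicator:
  assumes "T \<subseteq> set es"
  shows "config_embedding es n (\<sigma>, Z) (map (\<lambda>e. e \<in> T) es) = bits n (Z \<union> \<sigma> ` T)"
proof -
  have "(!) es ` ones (map (\<lambda>e. e \<in> T) es) = T"
  proof (intro equalityI subsetI)
    fix e assume "e \<in> T"
    moreover from this obtain j where "j < length es" "es ! j = e"
      using assms by (metis in_set_conv_nth subsetD)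
    ultimately show "e \<in> (!) es ` ones (map (\<lambda>e. e \<in> T) es)"
      by (intro image_eqI[of _ _ j]) (auto simp: ones_def)
  qed (auto simp: ones_def)
  then show ?thesis by (simp add: config_embedding_def cube_def)
qed

theorem theorem3p10:
  fixes G :: "('v, 'e) multigraph" and es :: "'e list"
  assumes "series_parallel G"
    and "connected_multigraph G"
    and "distinct es" and "set es = edges G"
  shows "\<exists>c\<^sub>1 c\<^sub>2 c\<^sub>3 c\<^sub>4 :: real. c\<^sub>1 > 0 \<and> c\<^sub>2 > 0 \<and> c\<^sub>3 > 0 \<and> c\<^sub>4 > 0 \<and>
    (\<forall>(n :: nat) (S :: bool list set) (\<delta> :: real).
       n \<ge> card (edges G) \<longrightarrow> S \<subseteq> cube n \<longrightarrow> real (card S) = \<delta> * 2 ^ n \<longrightarrow>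
       \<delta> \<ge> c\<^sub>1 * real n powr (- c\<^sub>2) \<longrightarrow>
       real (card {\<psi> \<in> oriented_embeddings (card (edges G)) n.
                     \<psi> ` spanning_tree_strings G es \<subseteq> S})
         / real (card (oriented_embeddings (card (edges G)) n))
       \<ge> c\<^sub>3 * \<delta> powr c\<^sub>4)"
proof -
  let ?d = "card (edges G)" and ?F = "trees (vertices G) (ends G) (edges G)"
  have wf: "wf_multigraph G" and no_minor: "\<not> is_minor K4 G"
    using assms(1) by (auto simp: series_parallel_def)
  have d: "length es = ?d" using distinct_card[OF assms(3)] assms(4) by simp
  have fin: "finite (edges G)" using wf by (simp add: wf_multigraph_def)
  have "polynomially_dense (edges G) ?F"
  proof (rule polynomially_dense_trees)
    show "connects (vertices G) (ends G) (edges G)"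
      using assms(2) by (simp add: connected_multigraph_def connects_def adjacency_def link_def)
    show "\<nexists>B. K4_model (vertices G) (link (ends G) (edges G)) B"
      using is_minor_K4_if_K4_model[OF wf] no_minor by blast
  qed (use wf assms(2) in \<open>auto simp: wf_multigraph_def connected_multigraph_def\<close>)
  then obtain C k where Ck: "C \<ge> 1" "k \<ge> 1"
    and dense: "\<And>n S \<delta>. S \<subseteq> Pow {..<n} \<Longrightarrow> real (card S) = \<delta> * 2 ^ n \<Longrightarrow> n = 0 \<or> C \<le> \<delta> ^ k * n \<Longrightarrow>
          \<delta> ^ k * n ^ ?d * 2 ^ n \<le> C * card (copies (edges G) ?F n S)"
    unfolding polynomially_dense_def by blast
  show ?thesis
  \<comment> \<open>For positive \<open>n\<close> the density assumption then reads
    \<open>\<delta> \<ge> (C / n) powr (1 / k)\<close>, whose \<open>k\<close>-th power is the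
    threshold \<open>C \<le> \<delta> ^ k * n\<close>. For \<open>n = 0\<close> it only says
    \<open>\<delta> \<ge> 0\<close>, because \<open>0 powr x = 0\<close>; this is the case treated
    apart in \<open>polynomially_dense\<close>.\<close>
  proof (rule exI[of _ "C powr (1 / k)"], rule exI[of _ "1 / real k"], rule exI[of _ "1 / C"],
      rule exI[of _ "real k"], intro conjI allI impI)
    fix n S \<delta>
    assume n: "?d \<le> n" and S: "S \<subseteq> cube n" "real (card S) = \<delta> * 2 ^ n"
      and \<delta>: "C powr (1 / k) * real n powr - (1 / real k) \<le> \<delta>"
    let ?O = "oriented_embeddings ?d n"
    let ?good = "{\<psi> \<in> ?O. \<psi> ` spanning_tree_strings G es \<subseteq> S}"
    have "0 \<le> \<delta>" using \<delta> by (rule order_trans[rotated]) simp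
    then have pow: "\<delta> powr real k = \<delta> ^ k"
      using Ck by (cases "\<delta> = 0") (auto simp: powr_realpow)
    have large: "n = 0 \<or> C \<le> \<delta> ^ k * n"
    proof (cases "n = 0")
      case False
      have "(C powr (1 / k) * real n powr - (1 / real k)) ^ k \<le> \<delta> ^ k"
        using \<delta> by (intro power_mono) auto
      moreover have "(C powr (1 / k) * real n powr - (1 / real k)) ^ k = C / n"
      proof -
        have "(x powr (1 / k)) ^ k = x" if "x > 0" for x :: real
          using Ck that by (simp add: powr_powr flip: powr_realpow)
        then show ?thesis
          using Ck False by (simp only: power_mult_distrib powr_minus power_inverse) (simp add: divide_inverse)
      qed
      ultimately have "C / n \<le> \<delta> ^ k" by linarith
      then show ?thesis using False by (simp add: field_simps)
    qed simp
    have O: "?O = config_embedding es n ` configurations (edges G) n"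
      using oriented_embeddings_eq[OF assms(3)] d assms(4) by simp
    have finO: "finite ?O" unfolding O using finite_configurations[OF fin] by simp
    have "card ?O \<le> n ^ ?d * 2 ^ n"
      unfolding O using card_image_le[OF finite_configurations[OF fin]] card_configurations_le[OF fin]
      by (rule order_trans)
    then have total: "real (card ?O) \<le> n ^ ?d * 2 ^ n"
      by (metis of_nat_le_iff)
    define S' where "S' = ones ` S"
    have "inj_on ones S"
      using S(1) bits_ones by (metis inj_on_inverseI subsetD)
    then have card_S': "card S' = card S" unfolding S'_def by (rule card_image)
    have "S' \<subseteq> Pow {..<n}" using S(1) by (auto simp: S'_def ones_def cube_def)
    then have "\<delta> ^ k * n ^ ?d * 2 ^ n \<le> C * card (copies (edges G) ?F n S')"
      using S(2) card_S' large by (intro dense) auto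
    also have "card (copies (edges G) ?F n S') \<le> card ?good"
    proof (rule card_inj_on_le)
      show "inj_on (config_embedding es n) (copies (edges G) ?F n S')"
        by (rule inj_on_subset[OF config_embedding_inj[OF assms(3)]]) (auto simp: copies_def assms(4))
      show "config_embedding es n ` copies (edges G) ?F n S' \<subseteq> ?good"
      proof
        fix \<psi> assume "\<psi> \<in> config_embedding es n ` copies (edges G) ?F n S'"
        then obtain \<sigma> Z where \<psi>: "\<psi> = config_embedding es n (\<sigma>, Z)" and c: "(\<sigma>, Z) \<in> copies (edges G) ?F n S'"
          by auto
        have "\<psi> x \<in> S" if "x \<in> spanning_tree_strings G es" for x
        proof -
          obtain T where T: "x = map (\<lambda>e. e \<in> T) es" "spanning_tree_edges G T"
            using \<open>x \<in> spanning_tree_strings G es\<close> by (auto simp: spanning_tree_strings_def)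
          then have "Z \<union> \<sigma> ` T \<in> S'"
            using c spanning_tree_edges_in_trees[OF wf] by (auto simp: copies_def)
          then obtain y where "y \<in> S" "Z \<union> \<sigma> ` T = ones y" by (auto simp: S'_def)
          moreover have "T \<subseteq> set es" using T(2) assms(4) by (simp add: spanning_tree_edges_def)
          ultimately show ?thesis
            using config_embedding_indicator[of T es n \<sigma> Z] bits_ones S(1) T(1) \<psi> by auto
        qed
        moreover have "\<psi> \<in> ?O" using c unfolding O \<psi> by (auto simp: copies_def)
        ultimately show "\<psi> \<in> ?good" by blast
      qed
      show "finite ?good" using finO by simp
    qed
    finally have count: "\<delta> ^ k * n ^ ?d * 2 ^ n \<le> C * card ?good" using Ck by simp
    show "1 / C * \<delta> powr real k \<le> card ?good / card ?O"
    \<comment> \<open>Division by 0 yields 0 here, so the left side has to vanish. It does, because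
      \<open>count\<close> forces \<open>\<delta> ^ k \<le> 0\<close>; for \<open>n = 0\<close> also
      \<open>?d = 0\<close>, and \<open>0 ^ 0 = 1\<close> keeps the normalising factor
      positive.\<close>
    proof (cases "card ?O = 0")
      case True
      then have "card ?good = 0" using finO by auto
      then have "\<delta> ^ k * (real n ^ ?d * 2 ^ n) \<le> 0" using count by (simp only: mult.assoc mult_zero_right of_nat_0 of_nat_power)
      moreover have "0 < real n ^ ?d * 2 ^ n" using n by (cases "n = 0") auto
      ultimately have "\<delta> ^ k \<le> 0" by (metis mult_le_0_iff not_le)
      then show ?thesis using True pow Ck by (simp add: divide_le_0_iff)
    next
      case False
      have "\<delta> ^ k * card ?O \<le> \<delta> ^ k * (n ^ ?d * 2 ^ n)"
        using total \<open>0 \<le> \<delta>\<close> by (intro mult_left_mono) auto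
      then have "\<delta> ^ k * card ?O \<le> C * card ?good" using count by (simp add: mult.assoc)
      then show ?thesis using False Ck pow by (simp add: field_simps)
    qed
  qed (use Ck in auto)
qed

end
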